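(* In an arbitrary geometric algebra $C\ell_{p,q,r}$, $p+q+r=n\ge1$, the groups $\check A^{\overline{12}}_{p,q,r}$, $\check A^{\overline{03}}_{p,q,r}$, $\check B^{\overline{01}}_{p,q,r}$, $\check B^{\overline{23}}_{p,q,r}$ and the groups $\check\Gamma^{\overline{kl}}_{p,q,r}$ (all defined in the context) satisfy $$\check A^{\overline{12}}_{p,q,r}=\psi^{-1}\big((\check Z^{1}_{p,q,r}\cap\check Z^{2}_{p,q,r})^{\times}\big)=\check\Gamma^{\overline{12}}_{p,q,r},$$ $$\check A^{\overline{03}}_{p,q,r}=\psi^{-1}\big((Z^{3}_{p,q,r}\cap C\ell^{(0)}_{p,q,r})^{\times}\big)=\check\Gamma^{\overline{03}}_{p,q,r},$$ $$\check B^{\overline{01}}_{p,q,r}=\chi^{-1}(\Lambda^{(0)\times}_r)=\check\Gamma^{\overline{01}}_{p,q,r}\ \subseteq\ \check B^{\overline{23}}_{p,q,r}=\chi^{-1}\big((\check Z^2_{p,q,r}\cap\check Z^3_{p,q,r})^{\times}\big)=\check\Gamma^{\overline{23}}_{p,q,r}.$$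
   Context: $C\ell_{p,q,r}$, $p+q+r=n\ge1$, is the Clifford (geometric) algebra over the real space $\mathbb{R}^{p,q,r}$ or the complex space $\mathbb{C}^{p+q,0,r}$ (field $\mathbb{F}=\mathbb{R}$ or $\mathbb{C}$ respectively), with identity $e$ and generators $e_1,\dots,e_n$ satisfying $e_ae_b+e_be_a=2\eta_{ab}e$, where $\eta$ is diagonal with $p$ entries $+1$, then $q$ entries $-1$, then $r$ entries $0$ (in the complex case, $p+q$ entries $+1$ and $r$ entries $0$). $C\ell^k_{p,q,r}$ is the grade-$k$ subspace, spanned by $e_{a_1}\cdots e_{a_k}$, $a_1<\dots<a_k$ (it is $\{0\}$ for $k<0$ or $k>n$). $\Lambda_r=C\ell_{0,0,r}$ is the Grassmann subalgebra generated by the $r$ null generators $e_{p+q+1},\dots,e_n$ (and $\Lambda_0=\mathbb{F}e$). $\widehat U$ is the grade involution (multiplication by $(-1)^k$ on grade $k$), $\widetilde U$ is the reversion (multiplication by $(-1)^{k(k-1)/2}$ on grade $k$, an anti-automorphism), $\widehat{\widetilde U}$ is the Clifford conjugation. $C\ell^{(0)}_{p,q,r}$ is the even subspace and $\Lambda^{(0)}_r=\Lambda_r\cap C\ell^{(0)}_{p,q,r}$. For $k=0,1,2,3$, $C\ell^{\overline{k}}_{p,q,r}=\{U:\ \widehat U=(-1)^kU,\ \widetilde U=(-1)^{k(k-1)/2}U\}$ (the direct sum of the subspaces of grades congruent to $k$ mod $4$), and $C\ell^{\overline{kl}}_{p,q,r}=C\ell^{\overline{k}}_{p,q,r}\oplus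 C\ell^{\overline{l}}_{p,q,r}$. For a subset $H\subseteq C\ell_{p,q,r}$, $H^\times$ denotes the set of invertible elements of $H$. Centralizers and twisted centralizers of grade subspaces: $Z^m_{p,q,r}=\{X\in C\ell_{p,q,r}:\ XV=VX\ \ \forall V\in C\ell^m_{p,q,r}\}$ and $\check Z^m_{p,q,r}=\{X\in C\ell_{p,q,r}:\ \widehat XV=VX\ \ \forall V\in C\ell^m_{p,q,r}\}$ (if $m>n$, then $C\ell^m_{p,q,r}=\{0\}$ and both are all of $C\ell_{p,q,r}$). Norm functions: $\psi(T)=\widetilde T T$, $\chi(T)=\widehat{\widetilde T}T$. Groups: $\check A^{\overline{12}}_{p,q,r}=\{T\in C\ell^\times_{p,q,r}:\ \widetilde TT\in(\check Z^1_{p,q,r}\cap\check Z^2_{p,q,r})^\times\}$, $\check A^{\overline{03}}_{p,q,r}=\{T\in C\ell^\times_{p,q,r}:\ \widetilde TT\in(Z^3_{p,q,r}\cap C\ell^{(0)}_{p,q,r})^\times\}$, $\check B^{\overline{01}}_{p,q,r}=\{T\in C\ell^\times_{p,q,r}:\ \widehat{\widetilde T}T\in(Z^1_{p,q,r}\cap C\ell^{(0)}_{p,q,r})^\times=\Lambda^{(0)\times}_r\}$, $\check B^{\overline{23}}_{p,q,r}=\{T\in C\ell^\times_{p,q,r}:\ \widehat{\widetilde T}T\in(\check Z^2_{p,q,r}\cap\check Z^3_{p,q,r})^\times\}$, and $\check\Gamma^{\overline{kl}}_{p,q,r}=\{T\in C\ell^\times_{p,q,r}:\ \widehat T\,C\ell^{\overline{kl}}_{p,q,r}\,T^{-1}\subseteq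 C\ell^{\overline{kl}}_{p,q,r}\}$. *)

theory Defs
  imports Complex_Main "HOL-Algebra.Module" "HOL-Algebra.AbelCoset"
begin

section \<open>The geometric algebra of signature (p, q, r)\<close>

text \<open>
  A multivector is given by its coordinates in the basis of blades
  \<open>e_A = e_(a1) ... e_(ak)\<close>, where \<open>A = {a1 < ... < ak} \<subseteq> {1..p+q+r}\<close>. The product is the
  bilinear extension of \<open>e_A e_B = blade_coeff p q A B * e_(sym_diff A B)\<close>: the sign counts the
  transpositions that sort the word \<open>e_A e_B\<close>, and each generator occurring in both factors
  contributes its square. That this is an associative algebra with unit, generated by \<open>e_1, ..., e_n\<close>
  subject to the Clifford relations, and with the ordered products of generators as a basis, is
  proved below.
\<close>

type_synonym 'f mv = "nat set \<Rightarrow> 'f"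

definition eta :: "nat \<Rightarrow> nat \<Rightarrow> nat \<Rightarrow> 'f::field" where
  "eta p q a = (if a \<le> p then 1 else if a \<le> p + q then - 1 else 0)"

definition blade_coeff :: "nat \<Rightarrow> nat \<Rightarrow> nat set \<Rightarrow> nat set \<Rightarrow> 'f::field" where
  "blade_coeff p q A B =
     (- 1) ^ card {(a, b). a \<in> A \<and> b \<in> B \<and> b < a} * (\<Prod>a\<in>A \<inter> B. eta p q a)"

text \<open>The real algebra of the paper is \<open>Cl p q r :: (real, real mv) module\<close>; the complex one is
  \<open>Cl (p + q) 0 r :: (complex, complex mv) module\<close>.\<close>

definition Cl :: "nat \<Rightarrow> nat \<Rightarrow> nat \<Rightarrow> ('f::field, 'f mv) module" where
  "Cl p q r =
     \<lparr> carrier = {U. \<forall>A. U A \<noteq> 0 \<longrightarrow> A \<subseteq> {1..p+q+r}},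
       mult = (\<lambda>U V C. \<Sum>(A, B) | A \<subseteq> {1..p+q+r} \<and> B \<subseteq> {1..p+q+r} \<and> sym_diff A B = C.
                 blade_coeff p q A B * U A * V B),
       one = (\<lambda>A. if A = {} then 1 else 0),
       zero = (\<lambda>A. 0),
       add = (\<lambda>U V A. U A + V A),
       smult = (\<lambda>c U A. c * U A) \<rparr>"

definition blade :: "nat set \<Rightarrow> 'f::field mv" where
  "blade A = (\<lambda>B. if B = A then 1 else 0)"

abbreviation gen :: "nat \<Rightarrow> 'f::field mv" where
  "gen a \<equiv> blade {a}"


section \<open>Grades and involutions\<close>

definition grade :: "nat \<Rightarrow> nat \<Rightarrow> nat \<Rightarrow> nat \<Rightarrow> 'f::field mv set" where
  "grade p q r k = {U \<in> carrier (Cl p q r). \<forall>A. U A \<noteq> 0 \<longrightarrow> card A = k}"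

definition even_part :: "nat \<Rightarrow> nat \<Rightarrow> nat \<Rightarrow> 'f::field mv set" where
  "even_part p q r = {U \<in> carrier (Cl p q r). \<forall>A. U A \<noteq> 0 \<longrightarrow> even (card A)}"

definition Grassmann :: "nat \<Rightarrow> nat \<Rightarrow> nat \<Rightarrow> 'f::field mv set" where
  "Grassmann p q r = {U \<in> carrier (Cl p q r). \<forall>A. U A \<noteq> 0 \<longrightarrow> A \<subseteq> {p+q+1..p+q+r}}"

definition Grassmann_even :: "nat \<Rightarrow> nat \<Rightarrow> nat \<Rightarrow> 'f::field mv set" where
  "Grassmann_even p q r = Grassmann p q r \<inter> even_part p q r"

definition hat :: "'f::field mv \<Rightarrow> 'f mv" where
  "hat U = (\<lambda>A. (- 1) ^ card A * U A)"

definition tilde :: "'f::field mv \<Rightarrow> 'f mv" where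
  "tilde U = (\<lambda>A. (- 1) ^ (card A * (card A - 1) div 2) * U A)"

text \<open>\<open>qtype p q r k\<close> is the subspace written \<open>Cl\<close> with an overlined \<open>k\<close>, and \<open>qtype2 p q r k l\<close>
  the one with an overlined \<open>kl\<close>; the sum is direct for distinct \<open>k\<close>, \<open>l\<close> in \<open>{0, 1, 2, 3}\<close>.\<close>

definition qtype :: "nat \<Rightarrow> nat \<Rightarrow> nat \<Rightarrow> nat \<Rightarrow> 'f::field mv set" where
  "qtype p q r k =
     {U \<in> carrier (Cl p q r).
        hat U = (- 1) ^ k \<odot>\<^bsub>Cl p q r\<^esub> U \<and>
        tilde U = (- 1) ^ (k * (k - 1) div 2) \<odot>\<^bsub>Cl p q r\<^esub> U}"

definition qtype2 :: "nat \<Rightarrow> nat \<Rightarrow> nat \<Rightarrow> nat \<Rightarrow> nat \<Rightarrow> 'f::field mv set" where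
  "qtype2 p q r k l = qtype p q r k <+>\<^bsub>Cl p q r\<^esub> qtype p q r l"


section \<open>Centralizers, norm functions and groups\<close>

text \<open>Invertibility is meant in the whole algebra.\<close>

definition invertibles :: "nat \<Rightarrow> nat \<Rightarrow> nat \<Rightarrow> 'f::field mv set \<Rightarrow> 'f mv set" where
  "invertibles p q r H = {X \<in> H. X \<in> Units (Cl p q r)}"

definition centralizer :: "nat \<Rightarrow> nat \<Rightarrow> nat \<Rightarrow> nat \<Rightarrow> 'f::field mv set" where
  "centralizer p q r m =
     {X \<in> carrier (Cl p q r). \<forall>V\<in>grade p q r m. X \<otimes>\<^bsub>Cl p q r\<^esub> V = V \<otimes>\<^bsub>Cl p q r\<^esub> X}"

definition twisted_centralizer :: "nat \<Rightarrow> nat \<Rightarrow> nat \<Rightarrow> nat \<Rightarrow> 'f::field mv set" where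
  "twisted_centralizer p q r m =
     {X \<in> carrier (Cl p q r). \<forall>V\<in>grade p q r m. hat X \<otimes>\<^bsub>Cl p q r\<^esub> V = V \<otimes>\<^bsub>Cl p q r\<^esub> X}"

definition psi :: "nat \<Rightarrow> nat \<Rightarrow> nat \<Rightarrow> 'f::field mv \<Rightarrow> 'f mv" where
  "psi p q r T = tilde T \<otimes>\<^bsub>Cl p q r\<^esub> T"

definition chi :: "nat \<Rightarrow> nat \<Rightarrow> nat \<Rightarrow> 'f::field mv \<Rightarrow> 'f mv" where
  "chi p q r T = hat (tilde T) \<otimes>\<^bsub>Cl p q r\<^esub> T"

text \<open>The norm functions are functions on the whole algebra, so that these preimages are not
  restricted to invertible elements in advance.\<close>

definition psi_preimage :: "nat \<Rightarrow> nat \<Rightarrow> nat \<Rightarrow> 'f::field mv set \<Rightarrow> 'f mv set" where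
  "psi_preimage p q r S = {T \<in> carrier (Cl p q r). psi p q r T \<in> S}"

definition chi_preimage :: "nat \<Rightarrow> nat \<Rightarrow> nat \<Rightarrow> 'f::field mv set \<Rightarrow> 'f mv set" where
  "chi_preimage p q r S = {T \<in> carrier (Cl p q r). chi p q r T \<in> S}"

text \<open>\<open>A12\<close>, \<open>A03\<close>, \<open>B01\<close>, \<open>B23\<close> and \<open>Gamma\<close> are the groups that carry a check accent
  and overlined indices.\<close>

definition A12 :: "nat \<Rightarrow> nat \<Rightarrow> nat \<Rightarrow> 'f::field mv set" where
  "A12 p q r =
     {T \<in> Units (Cl p q r). tilde T \<otimes>\<^bsub>Cl p q r\<^esub> T
        \<in> invertibles p q r (twisted_centralizer p q r 1 \<inter> twisted_centralizer p q r 2)}"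

definition A03 :: "nat \<Rightarrow> nat \<Rightarrow> nat \<Rightarrow> 'f::field mv set" where
  "A03 p q r =
     {T \<in> Units (Cl p q r). tilde T \<otimes>\<^bsub>Cl p q r\<^esub> T
        \<in> invertibles p q r (centralizer p q r 3 \<inter> even_part p q r)}"

definition B01 :: "nat \<Rightarrow> nat \<Rightarrow> nat \<Rightarrow> 'f::field mv set" where
  "B01 p q r =
     {T \<in> Units (Cl p q r). hat (tilde T) \<otimes>\<^bsub>Cl p q r\<^esub> T
        \<in> invertibles p q r (centralizer p q r 1 \<inter> even_part p q r)}"

definition B23 :: "nat \<Rightarrow> nat \<Rightarrow> nat \<Rightarrow> 'f::field mv set" where
  "B23 p q r =
     {T \<in> Units (Cl p q r). hat (tilde T) \<otimes>\<^bsub>Cl p q r\<^esub> T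
        \<in> invertibles p q r (twisted_centralizer p q r 2 \<inter> twisted_centralizer p q r 3)}"

definition Gamma :: "nat \<Rightarrow> nat \<Rightarrow> nat \<Rightarrow> nat \<Rightarrow> nat \<Rightarrow> 'f::field mv set" where
  "Gamma p q r k l =
     {T \<in> Units (Cl p q r). \<forall>V\<in>qtype2 p q r k l.
        hat T \<otimes>\<^bsub>Cl p q r\<^esub> V \<otimes>\<^bsub>Cl p q r\<^esub> inv\<^bsub>Cl p q r\<^esub> T \<in> qtype2 p q r k l}"


section \<open>Adequacy of the model\<close>

lemma sym_diff_cancel: "sym_diff A (sym_diff A B) = (B::'a set)"
  by auto

lemma Cl_mult_eq:
  fixes U V :: "'f::field mv"
  assumes "C \<subseteq> {1..p+q+r}"
  shows "(U \<otimes>\<^bsub>Cl p q r\<^esub> V) C =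
    (\<Sum>A\<in>Pow {1..p+q+r}. blade_coeff p q A (sym_diff A C) * U A * V (sym_diff A C))"
proof -
  have "(U \<otimes>\<^bsub>Cl p q r\<^esub> V) C = (\<Sum>(A, B) | A \<subseteq> {1..p+q+r} \<and> B \<subseteq> {1..p+q+r} \<and> sym_diff A B = C.
                 blade_coeff p q A B * U A * V B)"
    by (simp add: Cl_def)
  also have "{(A, B). A \<subseteq> {1..p+q+r} \<and> B \<subseteq> {1..p+q+r} \<and> sym_diff A B = C} =
      (\<lambda>A. (A, sym_diff A C)) ` Pow {1..p+q+r}" (is "?L = ?R")
  proof
    show "?L \<subseteq> ?R"
    proof
      fix x assume "x \<in> ?L"
      then obtain A B where x: "x = (A, B)" "A \<subseteq> {1..p+q+r}" "sym_diff A B = C" by blast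
      have "sym_diff A C = B" unfolding x(3)[symmetric] by (rule sym_diff_cancel)
      then show "x \<in> ?R" using x(1,2) by (intro image_eqI[of _ _ A]) (simp_all only: Pow_iff)
    qed
    show "?R \<subseteq> ?L"
    proof
      fix x assume "x \<in> ?R"
      then obtain A where "A \<subseteq> {1..p+q+r}" "x = (A, sym_diff A C)" by blast
      moreover have "sym_diff A C \<subseteq> {1..p+q+r}" using calculation(1) assms by blast
      ultimately show "x \<in> ?L" using sym_diff_cancel[of A C] by blast
    qed
  qed
  also have "(\<Sum>(A, B)\<in>?R. blade_coeff p q A B * U A * V B) =
      (\<Sum>A\<in>Pow {1..p+q+r}. blade_coeff p q A (sym_diff A C) * U A * V (sym_diff A C))"
    by (subst sum.reindex) (simp_all add: inj_on_def)
  finally show ?thesis .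
qed

lemma Cl_mult_outside:
  fixes U V :: "'f::field mv"
  assumes "\<not> C \<subseteq> {1..p+q+r}"
  shows "(U \<otimes>\<^bsub>Cl p q r\<^esub> V) C = 0"
proof -
  have e: "{(A, B). A \<subseteq> {1..p+q+r} \<and> B \<subseteq> {1..p+q+r} \<and> sym_diff A B = C} = {}"
    using assms by blast
  show ?thesis by (simp add: Cl_def e del: atLeastAtMost_iff One_nat_def)
qed

lemma carrier_Cl_iff:
  "U \<in> carrier (Cl p q r) \<longleftrightarrow> (\<forall>A. U A \<noteq> (0::'f::field) \<longrightarrow> A \<subseteq> {1..p+q+r})"
  by (simp add: Cl_def)

lemma Cl_mult_closed:
  "(U \<otimes>\<^bsub>Cl p q r\<^esub> V) \<in> carrier (Cl p q r :: ('f::field, 'f mv) module)"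
proof -
  have "A \<subseteq> {1..p+q+r}" if "(U \<otimes>\<^bsub>(Cl p q r :: ('f, 'f mv) module)\<^esub> V) A \<noteq> 0" for A
    using that Cl_mult_outside[of A p q r U V] by blast
  then show ?thesis unfolding carrier_Cl_iff by blast
qed

definition bsgn :: "nat set \<Rightarrow> nat set \<Rightarrow> 'f::field" where
  "bsgn A B = (\<Prod>a\<in>A. \<Prod>b\<in>B. if b < a then - 1 else 1)"

lemma bsgn_card:
  assumes "finite A" "finite B"
  shows "(- 1) ^ card {(a, b). a \<in> A \<and> b \<in> B \<and> b < a} = (bsgn A B :: 'f::field)"
proof -
  have "bsgn A B = (\<Prod>x\<in>A \<times> B. if snd x < fst x then - 1 else (1::'f))"
    unfolding bsgn_def by (subst prod.cartesian_product) (simp add: case_prod_beta)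
  also have "\<dots> = (\<Prod>x\<in>{x\<in>A \<times> B. snd x < fst x}. - 1)"
    using assms by (subst prod.inter_filter) auto
  also have "{x\<in>A \<times> B. snd x < fst x} = {(a, b). a \<in> A \<and> b \<in> B \<and> b < a}"
    by auto
  finally show ?thesis by simp
qed

lemma prod_sym_diff_sign:
  fixes f :: "'a \<Rightarrow> 'f::field"
  assumes "finite A" "finite B" "\<And>x. f x * f x = 1"
  shows "prod f (sym_diff A B) = prod f A * prod f B"
proof -
  have s: "prod f (A \<inter> B) * prod f (A \<inter> B) = 1"
    by (simp add: prod.distrib[symmetric] assms(3))
  have a: "prod f A = prod f (A - B) * prod f (A \<inter> B)"
    using assms by (subst prod.union_disjoint[symmetric]) (auto intro: prod.cong)
  have b: "prod f B = prod f (B - A) * prod f (A \<inter> B)"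
    using assms by (subst prod.union_disjoint[symmetric]) (auto intro: prod.cong)
  have "prod f (sym_diff A B) = prod f (A - B) * prod f (B - A)"
    using assms by (subst prod.union_disjoint[symmetric]) auto
  also have "\<dots> = prod f (A - B) * prod f (B - A) * (prod f (A \<inter> B) * prod f (A \<inter> B))"
    by (simp add: s)
  finally show ?thesis unfolding a b by (simp add: mult_ac)
qed

lemma bsgn_left:
  assumes "finite A" "finite B"
  shows "(bsgn (sym_diff A B) C :: 'f::field) = bsgn A C * bsgn B C"
  unfolding bsgn_def using assms
  by (intro prod_sym_diff_sign) (auto simp: prod.distrib[symmetric] intro!: prod.neutral)

lemma bsgn_right:
  assumes "finite B" "finite C"
  shows "(bsgn A (sym_diff B C) :: 'f::field) = bsgn A B * bsgn A C"
  unfolding bsgn_def prod.distrib[symmetric] using assms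
  by (intro prod.cong refl prod_sym_diff_sign) auto

lemma blade_coeff_bsgn:
  "finite A \<Longrightarrow> finite B \<Longrightarrow>
    blade_coeff p q A B = (bsgn A B * prod (eta p q) (A \<inter> B) :: 'f::field)"
  by (simp only: blade_coeff_def bsgn_card)

lemma blade_coeff_cocycle:
  assumes "finite A" "finite B" "finite C"
  shows "blade_coeff p q A B * blade_coeff p q (sym_diff A B) C =
    blade_coeff p q A (sym_diff B C) * (blade_coeff p q B C :: 'f::field)"
proof -
  let ?e = "prod (eta p q) :: nat set \<Rightarrow> 'f"
  have "?e (A \<inter> B) * ?e (sym_diff A B \<inter> C) = ?e ((A \<inter> B) \<union> (sym_diff A B \<inter> C))"
    using assms by (subst prod.union_disjoint) auto
  moreover have "?e (A \<inter> sym_diff B C) * ?e (B \<inter> C) = ?e ((A \<inter> sym_diff B C) \<union> (B \<inter> C))"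
    using assms by (subst prod.union_disjoint) auto
  moreover have "(A \<inter> B) \<union> (sym_diff A B \<inter> C) = (A \<inter> sym_diff B C) \<union> (B \<inter> C)"
    by auto
  ultimately have e: "?e (A \<inter> B) * ?e (sym_diff A B \<inter> C) = ?e (A \<inter> sym_diff B C) * ?e (B \<inter> C)"
    by simp
  have "bsgn A B * bsgn (sym_diff A B) C * (?e (A \<inter> B) * ?e (sym_diff A B \<inter> C)) =
        bsgn A (sym_diff B C) * bsgn B C * (?e (A \<inter> sym_diff B C) * ?e (B \<inter> C))"
    unfolding e using assms by (simp add: bsgn_left bsgn_right mult_ac)
  then show ?thesis
    using assms by (simp only: blade_coeff_bsgn finite_Un finite_Diff simp_thms) (simp only: mult_ac)
qed

lemma Cl_mult_assoc:
  fixes U V W :: "'f::field mv"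
  shows "U \<otimes>\<^bsub>Cl p q r\<^esub> V \<otimes>\<^bsub>Cl p q r\<^esub> W = U \<otimes>\<^bsub>Cl p q r\<^esub> (V \<otimes>\<^bsub>Cl p q r\<^esub> W)"
proof
  fix D :: "nat set"
  let ?N = "{1..p+q+r}"
  let ?k = "blade_coeff p q :: nat set \<Rightarrow> nat set \<Rightarrow> 'f"
  show "(U \<otimes>\<^bsub>Cl p q r\<^esub> V \<otimes>\<^bsub>Cl p q r\<^esub> W) D = (U \<otimes>\<^bsub>Cl p q r\<^esub> (V \<otimes>\<^bsub>Cl p q r\<^esub> W)) D"
  proof (cases "D \<subseteq> ?N")
    case D: True
    have fin: "finite A" if "A \<subseteq> ?N" for A using that finite_subset by blast
    have "(U \<otimes>\<^bsub>Cl p q r\<^esub> V \<otimes>\<^bsub>Cl p q r\<^esub> W) D =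
      (\<Sum>E\<in>Pow ?N. \<Sum>A\<in>Pow ?N. ?k E (sym_diff E D) * (?k A (sym_diff A E) * U A * V (sym_diff A E)) * W (sym_diff E D))"
      using D by (simp add: Cl_mult_eq sum_distrib_left sum_distrib_right)
    also have "\<dots> = (\<Sum>A\<in>Pow ?N. \<Sum>E\<in>Pow ?N. ?k E (sym_diff E D) * (?k A (sym_diff A E) * U A * V (sym_diff A E)) * W (sym_diff E D))"
      by (rule sum.swap)
    also have "\<dots> = (\<Sum>A\<in>Pow ?N. \<Sum>F\<in>Pow ?N. ?k A (sym_diff A D) * U A * (?k F (sym_diff F (sym_diff A D)) * V F * W (sym_diff F (sym_diff A D))))"
    proof (rule sum.cong[OF refl])
      fix A assume A: "A \<in> Pow ?N"
      show "(\<Sum>E\<in>Pow ?N. ?k E (sym_diff E D) * (?k A (sym_diff A E) * U A * V (sym_diff A E)) * W (sym_diff E D)) =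
        (\<Sum>F\<in>Pow ?N. ?k A (sym_diff A D) * U A * (?k F (sym_diff F (sym_diff A D)) * V F * W (sym_diff F (sym_diff A D))))"
      proof (rule sum.reindex_bij_witness[of _ "sym_diff A" "sym_diff A"])
        fix E assume E: "E \<in> Pow ?N"
        have 1: "sym_diff (sym_diff A E) (sym_diff A D) = sym_diff E D" by auto
        have 2: "sym_diff A (sym_diff A E) = E" by auto
        have 3: "sym_diff (sym_diff A E) (sym_diff E D) = sym_diff A D" by auto
        have "?k A (sym_diff A E) * ?k E (sym_diff E D) =
              ?k A (sym_diff A D) * ?k (sym_diff A E) (sym_diff E D)"
          using blade_coeff_cocycle[of A "sym_diff A E" "sym_diff E D" p q] A D E
          unfolding 2 3 by (simp add: fin)
        then show "?k A (sym_diff A D) * U A * (?k (sym_diff A E) (sym_diff (sym_diff A E) (sym_diff A D)) * V (sym_diff A E) * W (sym_diff (sym_diff A E) (sym_diff A D))) =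
          ?k E (sym_diff E D) * (?k A (sym_diff A E) * U A * V (sym_diff A E)) * W (sym_diff E D)"
          unfolding 1 by (simp add: mult_ac)
      qed (use A in auto)
    qed
    also have "\<dots> = (\<Sum>A\<in>Pow ?N. ?k A (sym_diff A D) * U A * (V \<otimes>\<^bsub>Cl p q r\<^esub> W) (sym_diff A D))"
    proof (rule sum.cong[OF refl])
      fix A assume "A \<in> Pow ?N"
      then have "sym_diff A D \<subseteq> ?N" using D by auto
      then show "(\<Sum>F\<in>Pow ?N. ?k A (sym_diff A D) * U A * (?k F (sym_diff F (sym_diff A D)) * V F * W (sym_diff F (sym_diff A D)))) =
          ?k A (sym_diff A D) * U A * (V \<otimes>\<^bsub>Cl p q r\<^esub> W) (sym_diff A D)"
        by (simp add: Cl_mult_eq sum_distrib_left)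
    qed
    also have "\<dots> = (U \<otimes>\<^bsub>Cl p q r\<^esub> (V \<otimes>\<^bsub>Cl p q r\<^esub> W)) D"
      using D by (simp add: Cl_mult_eq)
    finally show ?thesis .
  qed (simp add: Cl_mult_outside)
qed

lemma blade_mult:
  assumes "A \<subseteq> {1..p+q+r}" "B \<subseteq> {1..p+q+r}"
  shows "blade A \<otimes>\<^bsub>Cl p q r\<^esub> blade B =
    (blade_coeff p q A B :: 'f::field) \<odot>\<^bsub>Cl p q r\<^esub> blade (sym_diff A B)"
proof
  fix C
  show "(blade A \<otimes>\<^bsub>Cl p q r\<^esub> blade B) C =
    ((blade_coeff p q A B :: 'f) \<odot>\<^bsub>Cl p q r\<^esub> blade (sym_diff A B)) C"
  proof (cases "C \<subseteq> {1..p+q+r}")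
    case True
    have "(blade A \<otimes>\<^bsub>Cl p q r\<^esub> blade B) C =
      (\<Sum>A'\<in>Pow {1..p+q+r}. if A' = A then blade_coeff p q A (sym_diff A C) * blade B (sym_diff A C) else (0::'f))"
      unfolding Cl_mult_eq[OF True] by (intro sum.cong) (auto simp: blade_def)
    also have "\<dots> = blade_coeff p q A (sym_diff A C) * blade B (sym_diff A C)"
      using assms by simp
    also have "\<dots> = blade_coeff p q A B * blade (sym_diff A B) C"
      using sym_diff_cancel[of A B] sym_diff_cancel[of A C] by (auto simp: blade_def)
    finally show ?thesis by (simp add: Cl_def)
  next
    case False
    then have "C \<noteq> sym_diff A B" using assms by blast
    then show ?thesis by (simp add: Cl_mult_outside[OF False]) (simp add: Cl_def blade_def)
  qed
qed

lemma one_Cl: "\<one>\<^bsub>Cl p q r\<^esub> = (blade {} :: 'f::field mv)"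
  by (auto simp: Cl_def blade_def)

lemma Cl_one_left:
  assumes "U \<in> carrier (Cl p q r)"
  shows "\<one>\<^bsub>Cl p q r\<^esub> \<otimes>\<^bsub>Cl p q r\<^esub> U = (U :: 'f::field mv)"
proof
  fix C
  show "(\<one>\<^bsub>Cl p q r\<^esub> \<otimes>\<^bsub>Cl p q r\<^esub> U) C = U C"
  proof (cases "C \<subseteq> {1..p+q+r}")
    case True
    have "(\<one>\<^bsub>Cl p q r\<^esub> \<otimes>\<^bsub>Cl p q r\<^esub> U) C = (\<Sum>A\<in>Pow {1..p+q+r}. if A = {} then U C else 0)"
      unfolding Cl_mult_eq[OF True] by (intro sum.cong) (auto simp: one_Cl blade_def blade_coeff_def)
    then show ?thesis by simp
  next
    case False
    then have "U C = 0" using assms by (auto simp: Cl_def)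
    then show ?thesis using Cl_mult_outside[OF False] by metis
  qed
qed

lemma Cl_one_right:
  assumes "U \<in> carrier (Cl p q r)"
  shows "U \<otimes>\<^bsub>Cl p q r\<^esub> \<one>\<^bsub>Cl p q r\<^esub> = (U :: 'f::field mv)"
proof
  fix C
  show "(U \<otimes>\<^bsub>Cl p q r\<^esub> \<one>\<^bsub>Cl p q r\<^esub>) C = U C"
  proof (cases "C \<subseteq> {1..p+q+r}")
    case True
    have "(U \<otimes>\<^bsub>Cl p q r\<^esub> \<one>\<^bsub>Cl p q r\<^esub>) C = (\<Sum>A\<in>Pow {1..p+q+r}. if A = C then U C else 0)"
      unfolding Cl_mult_eq[OF True]
    proof (intro sum.cong refl)
      fix A
      have "sym_diff A C = {} \<longleftrightarrow> A = C" by blast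
      then show "blade_coeff p q A (sym_diff A C) * U A * \<one>\<^bsub>Cl p q r\<^esub> (sym_diff A C) =
        (if A = C then U C else 0)"
        by (auto simp: one_Cl blade_def blade_coeff_def)
    qed
    then show ?thesis using True by simp
  next
    case False
    then have "U C = 0" using assms by (auto simp: Cl_def)
    then show ?thesis using Cl_mult_outside[OF False] by metis
  qed
qed

lemma Cl_distrib:
  fixes U V W :: "'f::field mv"
  shows "(U \<oplus>\<^bsub>Cl p q r\<^esub> V) \<otimes>\<^bsub>Cl p q r\<^esub> W =
           U \<otimes>\<^bsub>Cl p q r\<^esub> W \<oplus>\<^bsub>Cl p q r\<^esub> V \<otimes>\<^bsub>Cl p q r\<^esub> W" (is ?l)
    and "W \<otimes>\<^bsub>Cl p q r\<^esub> (U \<oplus>\<^bsub>Cl p q r\<^esub> V) =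
           W \<otimes>\<^bsub>Cl p q r\<^esub> U \<oplus>\<^bsub>Cl p q r\<^esub> W \<otimes>\<^bsub>Cl p q r\<^esub> V" (is ?r)
proof -
  show ?l ?r
    by (auto simp: Cl_def fun_eq_iff algebra_simps sum.distrib[symmetric] case_prod_beta)
qed

lemma Cl_add_comm_group:
  "abelian_group (Cl p q r :: ('f::field, 'f mv) module)"
proof (rule abelian_groupI)
  fix x :: "'f mv"
  assume "x \<in> carrier (Cl p q r)"
  then have "(\<lambda>A. - x A) \<in> carrier (Cl p q r)"
    "(\<lambda>A. - x A) \<oplus>\<^bsub>Cl p q r\<^esub> x = \<zero>\<^bsub>Cl p q r\<^esub>"
    by (auto simp: Cl_def)
  then show "\<exists>y\<in>carrier (Cl p q r). y \<oplus>\<^bsub>Cl p q r\<^esub> x = \<zero>\<^bsub>Cl p q r\<^esub>" by blast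
next
  fix x y :: "'f mv"
  assume "x \<in> carrier (Cl p q r)" "y \<in> carrier (Cl p q r)"
  then show "x \<oplus>\<^bsub>Cl p q r\<^esub> y \<in> carrier (Cl p q r)"
    unfolding Cl_def by simp (metis add_0)
qed (auto simp: Cl_def add_ac)

theorem Cl_ring: "ring (Cl p q r :: ('f::field, 'f mv) module)"
proof (rule ringI)
  show "monoid (Cl p q r :: ('f, 'f mv) module)"
  proof (rule monoidI)
    show "\<one>\<^bsub>Cl p q r\<^esub> \<in> carrier (Cl p q r :: ('f, 'f mv) module)"
      by (simp add: Cl_def)
  next
    fix x y z :: "'f mv"
    show "x \<otimes>\<^bsub>Cl p q r\<^esub> y \<in> carrier (Cl p q r)" by (rule Cl_mult_closed)
    show "x \<otimes>\<^bsub>Cl p q r\<^esub> y \<otimes>\<^bsub>Cl p q r\<^esub> z = x \<otimes>\<^bsub>Cl p q r\<^esub> (y \<otimes>\<^bsub>Cl p q r\<^esub> z)"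
      by (rule Cl_mult_assoc)
  next
    fix x :: "'f mv"
    assume x: "x \<in> carrier (Cl p q r)"
    show "\<one>\<^bsub>Cl p q r\<^esub> \<otimes>\<^bsub>Cl p q r\<^esub> x = x" by (rule Cl_one_left[OF x])
    show "x \<otimes>\<^bsub>Cl p q r\<^esub> \<one>\<^bsub>Cl p q r\<^esub> = x" by (rule Cl_one_right[OF x])
  qed
qed (rule Cl_add_comm_group, rule Cl_distrib(1), rule Cl_distrib(2))

theorem Cl_smult_mult:
  fixes U V :: "'f::field mv"
  shows "(c \<odot>\<^bsub>Cl p q r\<^esub> U) \<otimes>\<^bsub>Cl p q r\<^esub> V = c \<odot>\<^bsub>Cl p q r\<^esub> (U \<otimes>\<^bsub>Cl p q r\<^esub> V)"
    and "U \<otimes>\<^bsub>Cl p q r\<^esub> (c \<odot>\<^bsub>Cl p q r\<^esub> V) = c \<odot>\<^bsub>Cl p q r\<^esub> (U \<otimes>\<^bsub>Cl p q r\<^esub> V)"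
  unfolding Cl_def fun_eq_iff
  by (auto simp only: module.simps ring.simps monoid.simps sum_distrib_left split_def mult_ac)

theorem Clifford_relations:
  assumes "a \<in> {1..p+q+r}" "b \<in> {1..p+q+r}"
  shows "gen a \<otimes>\<^bsub>Cl p q r\<^esub> gen b \<oplus>\<^bsub>Cl p q r\<^esub> gen b \<otimes>\<^bsub>Cl p q r\<^esub> gen a =
    (2 * (if a = b then eta p q a else 0) :: 'f::field) \<odot>\<^bsub>Cl p q r\<^esub> \<one>\<^bsub>Cl p q r\<^esub>"
proof -
  have *: "blade_coeff p q {c} {d} = (if d < c then - 1 else if d = c then eta p q c else (1::'f))"
    for c d :: nat
    by (cases "c = d") (simp_all add: blade_coeff_bsgn bsgn_def)
  have mult: "gen c \<otimes>\<^bsub>Cl p q r\<^esub> gen d = blade_coeff p q {c} {d} \<odot>\<^bsub>Cl p q r\<^esub> blade (sym_diff {c} {d})"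
    if "c \<in> {1..p+q+r}" "d \<in> {1..p+q+r}" for c d
    using that by (intro blade_mult) blast+
  have lin: "x \<odot>\<^bsub>Cl p q r\<^esub> X \<oplus>\<^bsub>Cl p q r\<^esub> y \<odot>\<^bsub>Cl p q r\<^esub> X = (x + y) \<odot>\<^bsub>Cl p q r\<^esub> X"
    for x y :: 'f and X
    by (simp add: Cl_def distrib_right)
  have comm: "sym_diff {b} {a} = sym_diff {a} {b}" by (rule Un_commute)
  show ?thesis
  proof (cases "a = b")
    case True
    then have "sym_diff {a} {b} = {}" by blast
    then show ?thesis using True unfolding mult[OF assms] mult[OF assms(2,1)] comm lin * one_Cl by simp
  next
    case False
    then have "blade_coeff p q {a} {b} + blade_coeff p q {b} {a} = (0::'f)"
      by (auto simp: *)
    then show ?thesis using False unfolding mult[OF assms] mult[OF assms(2,1)] comm lin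
      by (simp add: Cl_def)
  qed
qed

theorem blade_insert:
  assumes "A \<subseteq> {1..p+q+r}" "a \<in> {1..p+q+r}" "\<And>b. b \<in> A \<Longrightarrow> a < b"
  shows "blade (insert a A) = (gen a \<otimes>\<^bsub>Cl p q r\<^esub> blade A :: 'f::field mv)"
proof -
  have "{(x, y). x \<in> {a} \<and> y \<in> A \<and> y < x} = {}" "{a} \<inter> A = {}" "sym_diff {a} A = insert a A"
    using assms(3) less_asym by blast+
  then have "blade_coeff p q {a} A = (1::'f)" by (simp only: blade_coeff_def card.empty power_0 prod.empty mult_1)
  with \<open>sym_diff {a} A = insert a A\<close> show ?thesis
    using assms(1,2) by (subst blade_mult) (auto simp: Cl_def)
qed

theorem blade_expansion:
  assumes "U \<in> carrier (Cl p q r)"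
  shows "U = (\<Oplus>\<^bsub>Cl p q r\<^esub>A\<in>Pow {1..p+q+r}. U A \<odot>\<^bsub>Cl p q r\<^esub> (blade A :: 'f::field mv))"
proof -
  interpret ring "Cl p q r :: ('f, 'f mv) module" by (rule Cl_ring)
  have car: "U A \<odot>\<^bsub>Cl p q r\<^esub> blade A \<in> carrier (Cl p q r)" if "A \<subseteq> {1..p+q+r}" for A
    using that by (auto simp: Cl_def blade_def)
  have add: "(X \<oplus>\<^bsub>Cl p q r\<^esub> Y) B = X B + Y B" for X Y :: "'f mv" and B
    by (simp add: Cl_def)
  have sm: "(U A \<odot>\<^bsub>Cl p q r\<^esub> blade A) B = (if B = A then U A else 0)" for A B
    by (simp add: Cl_def blade_def)
  have zero: "\<zero>\<^bsub>Cl p q r\<^esub> B = (0::'f)" for B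
    by (simp add: Cl_def)
  have "finsum (Cl p q r) (\<lambda>A. U A \<odot>\<^bsub>Cl p q r\<^esub> blade A) S B = (if B \<in> S then U B else 0)"
    if "finite S" "S \<subseteq> Pow {1..p+q+r}" for S B
    using that
  proof (induction S)
    case (insert A S)
    have "finsum (Cl p q r) (\<lambda>A. U A \<odot>\<^bsub>Cl p q r\<^esub> blade A) (insert A S) =
      (U A \<odot>\<^bsub>Cl p q r\<^esub> blade A) \<oplus>\<^bsub>Cl p q r\<^esub> finsum (Cl p q r) (\<lambda>A. U A \<odot>\<^bsub>Cl p q r\<^esub> blade A) S"
      using insert car by (intro finsum_insert) auto
    then have "finsum (Cl p q r) (\<lambda>A. U A \<odot>\<^bsub>Cl p q r\<^esub> blade A) (insert A S) B =
      (if B = A then U A else 0) + (if B \<in> S then U B else 0)"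
      using insert by (simp only: add sm[of A B]) simp
    then show ?case using insert.hyps by auto
  qed (simp add: zero)
  moreover have "U B = 0" if "B \<notin> Pow {1..p+q+r}" for B
    using assms that by (auto simp: Cl_def)
  ultimately show ?thesis
    by (intro ext) (simp add: subset_eq)
qed

end

theory Submission
  imports Defs "HOL-Library.Function_Algebras"
begin

text \<open>
  Let \<open>\<sigma>\<close> be the reversion or the Clifford conjugation. It is an anti-automorphism, and each of the
  four subspaces \<open>qtype2 p q r k l\<close> in the theorem is an eigenspace of one of the two, with eigenvalue
  \<open>c = 1\<close> or \<open>c = - 1\<close>: the signs of the reversion on the grades \<open>0, 1, 2, 3\<close> modulo \<open>4\<close> are
  \<open>+ + - -\<close> and those of the conjugation are \<open>+ - - +\<close>. For a unit \<open>T\<close> and \<open>\<sigma> V = c V\<close>, comparing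
  \<open>\<sigma>\<close> of \<open>hat T V inv T\<close> with \<open>c\<close> times this element, and multiplying by \<open>\<sigma> T\<close> on the left and by \<open>T\<close>
  on the right, gives \<open>V W = hat W V\<close> with the norm \<open>W = hat (\<sigma> T) T\<close>
  (\<open>conjugate_eigenvector_iff\<close>). The norm is \<open>chi\<close> when \<open>\<sigma>\<close> is the reversion and \<open>psi\<close> when \<open>\<sigma>\<close>
  is the conjugation. So \<open>T\<close> lies in \<open>Gamma p q r k l\<close> if and only if its norm lies in the twisted
  centralizers of all grades congruent to \<open>k\<close> or \<open>l\<close> modulo \<open>4\<close>.

  It remains to see that the two grades \<open>k\<close> and \<open>l\<close> impose all these conditions. Multiplication by a
  fixed blade permutes the blades up to scalars, so \<open>hat W e_B = e_B W\<close> is a condition on each single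
  blade in the support of \<open>W\<close>: for every \<open>A\<close> with \<open>W A \<noteq> 0\<close>, either \<open>A \<inter> B\<close> contains a null
  generator, and both products vanish, or a parity depending on the cardinalities of \<open>A\<close>, \<open>B\<close> and
  \<open>A \<inter> B\<close> is even (\<open>twisted_commute_blade_iff\<close>). The question becomes one about finite sets:
  if the parity fails for a large \<open>B\<close>, it fails already for a subset of \<open>B\<close> with \<open>k\<close> or \<open>l\<close> elements.
  The lemmas \<open>twisted_support_12\<close>, \<open>twisted_support_03\<close>, \<open>twisted_support_01\<close> and
  \<open>twisted_support_23\<close> do this for the four pairs. The even part is the twisted centralizer of
  grade \<open>0\<close>, and on it the twist is trivial, which accounts for the groups that are defined by an
  untwisted centralizer. An even element of the Grassmann subalgebra satisfies the conditions of all
  grades, whence the inclusion of \<open>Gamma p q r 0 1\<close> in \<open>B23 p q r\<close>.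

  The preimages under \<open>psi\<close> and \<open>chi\<close> run over all \<open>T\<close>, but an invertible norm makes \<open>T\<close> left
  invertible, and in a finite-dimensional algebra this makes \<open>T\<close> a unit
  (\<open>Cl_left_invertible_Units\<close>).
\<close>

section \<open>The involutions\<close>

lemma bsgn_square: "bsgn A B * bsgn A B = (1 :: 'f::field)"
  unfolding bsgn_def by (simp add: prod.distrib[symmetric] if_distrib cong: if_cong)

text \<open>
  Exactly one of \<open>b < a\<close> and \<open>a < b\<close> holds unless \<open>a = b\<close>, so the two signs together count the
  pairs in \<open>A \<times> B\<close> off the diagonal.
\<close>

lemma bsgn_commute:
  assumes "finite A" "finite B"
  shows "bsgn A B * bsgn B A = (- 1 :: 'f::field) ^ (card A * card B + card (A \<inter> B))"
proof -
  have "bsgn A B * bsgn B A =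
      (\<Prod>a\<in>A. \<Prod>b\<in>B. (if b < a then - 1 else 1) * (if a < b then - 1 else (1::'f)))"
    unfolding bsgn_def by (subst prod.swap[of _ A B]) (simp add: prod.distrib)
  also have "\<dots> = (\<Prod>a\<in>A. \<Prod>b\<in>B. - 1 * (if b = a then - 1 else 1))"
    by (intro prod.cong) auto
  also have "\<dots> = (\<Prod>a\<in>A. (- 1) ^ card B * (if a \<in> B then - 1 else 1))"
    using assms by (intro prod.cong refl) (subst prod.distrib, simp)
  also have "\<dots> = (- 1) ^ (card A * card B) * (\<Prod>a\<in>A. if a \<in> B then - 1 else 1)"
    by (simp add: prod.distrib power_mult[symmetric] mult.commute)
  also have "(\<Prod>a\<in>A. if a \<in> B then - 1 else (1::'f)) = (\<Prod>a\<in>{a\<in>A. a \<in> B}. - 1)"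
    using assms by (subst prod.inter_filter) auto
  also have "{a\<in>A. a \<in> B} = A \<inter> B" by auto
  finally show ?thesis by (simp add: power_add)
qed

text \<open>
  The sign of the reversion on a blade counts the inversions of the reversed word, that is, the
  pairs \<open>b < a\<close> in \<open>A\<close>. Written as \<open>bsgn A A\<close>, it inherits bilinearity under symmetric differences,
  from which \<open>tilde_mult\<close> follows without any counting of cardinalities.
\<close>

lemma bsgn_self:
  assumes "finite A"
  shows "bsgn A A = (- 1 :: 'f::field) ^ (card A * (card A - 1) div 2)"
  using assms
proof (induction A rule: finite_linorder_max_induct)
  case empty
  then show ?case by (simp add: bsgn_def)
next
  case (insert m A)
  have m: "m \<notin> A" using insert.hyps by auto
  have s: "insert m A = sym_diff A {m}" using m by auto
  have "bsgn A {m} = (\<Prod>a\<in>A. 1 :: 'f)"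
    unfolding bsgn_def using insert.hyps by (intro prod.cong) auto
  then have "bsgn (insert m A) (insert m A) = bsgn {m} A * (bsgn A A :: 'f)"
    unfolding s using insert.hyps by (simp add: bsgn_left bsgn_right) (simp add: bsgn_def)
  also have "bsgn {m} A = (- 1 :: 'f) ^ card A"
    unfolding bsgn_def using insert.hyps by simp
  also have "(- 1 :: 'f) ^ card A * bsgn A A = (- 1) ^ (card A + card A * (card A - 1) div 2)"
    using insert.IH by (simp add: power_add)
  also have "card A + card A * (card A - 1) div 2 =
      card (insert m A) * (card (insert m A) - 1) div 2"
  proof -
    have "card A + card A * (card A - 1) div 2 = (card A * 2 + card A * (card A - 1)) div 2"
      by simp
    also have "card A * 2 + card A * (card A - 1) = Suc (card A) * card A"
      by (cases "card A") auto
    finally show ?thesis using insert.hyps m by simp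
  qed
  finally show ?case .
qed

lemma tilde_bsgn:
  assumes "U \<in> carrier (Cl p q r)"
  shows "tilde U A = bsgn A A * (U A :: 'f::field)"
proof (cases "U A = 0")
  case False
  then have "finite A" using assms finite_subset unfolding carrier_Cl_iff by blast
  then show ?thesis by (simp add: tilde_def bsgn_self)
qed (simp add: tilde_def)

lemma hat_closed: "U \<in> carrier (Cl p q r) \<Longrightarrow> hat U \<in> carrier (Cl p q r :: ('f::field, 'f mv) module)"
  by (auto simp: carrier_Cl_iff hat_def)

lemma tilde_closed: "U \<in> carrier (Cl p q r) \<Longrightarrow> tilde U \<in> carrier (Cl p q r :: ('f::field, 'f mv) module)"
  by (auto simp: carrier_Cl_iff tilde_def)

lemma hat_hat [simp]: "hat (hat U) = U"
  by (simp add: hat_def fun_eq_iff power_add[symmetric] mult.assoc[symmetric] flip: mult_2)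

lemma hat_tilde: "hat (tilde U) = tilde (hat U)"
  by (simp add: hat_def tilde_def fun_eq_iff mult_ac)

lemma hat_one: "hat \<one>\<^bsub>Cl p q r\<^esub> = (\<one>\<^bsub>Cl p q r\<^esub> :: 'f::field mv)"
  by (auto simp: hat_def Cl_def)

lemma tilde_one: "tilde \<one>\<^bsub>Cl p q r\<^esub> = (\<one>\<^bsub>Cl p q r\<^esub> :: 'f::field mv)"
  by (auto simp: tilde_def Cl_def)

lemma hat_mult:
  fixes U V :: "'f::field mv"
  shows "hat (U \<otimes>\<^bsub>Cl p q r\<^esub> V) = hat U \<otimes>\<^bsub>Cl p q r\<^esub> hat V"
proof
  fix C
  have "(- 1) ^ card C * (blade_coeff p q A B * U A * V B) =
      blade_coeff p q A B * hat U A * hat V B"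
    if "A \<subseteq> {1..p+q+r}" "B \<subseteq> {1..p+q+r}" "sym_diff A B = C" for A B
  proof -
    have fin: "finite A" "finite B" using that finite_subset by blast+
    have "(- 1 :: 'f) ^ card C = (- 1) ^ card A * (- 1) ^ card B"
      using prod_sym_diff_sign[OF fin, of "\<lambda>_. - 1 :: 'f"] that(3) by simp
    then show ?thesis by (simp add: hat_def mult_ac)
  qed
  then show "hat (U \<otimes>\<^bsub>Cl p q r\<^esub> V) C = (hat U \<otimes>\<^bsub>Cl p q r\<^esub> hat V) C"
    unfolding hat_def[of "U \<otimes>\<^bsub>Cl p q r\<^esub> V"]
    by (simp add: Cl_def sum_distrib_left split_def del: atLeastAtMost_iff) (intro sum.cong; auto)
qed

text \<open>
  The product summed over the transposed index pairs, so that two products with the factors in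
  opposite orders can be compared term by term.
\<close>

lemma Cl_mult_swap:
  fixes U V :: "'f::field mv"
  shows "(U \<otimes>\<^bsub>Cl p q r\<^esub> V) C =
    (\<Sum>(B, A) | B \<subseteq> {1..p+q+r} \<and> A \<subseteq> {1..p+q+r} \<and> sym_diff B A = C.
      blade_coeff p q A B * U A * V B)"
  unfolding Cl_def monoid.simps
  by (rule sum.reindex_bij_witness[of _ prod.swap prod.swap]) auto

text \<open>
  Expanding \<open>bsgn C C\<close> for \<open>C = sym_diff A B\<close> bilinearly gives the signs of \<open>A\<close> and \<open>B\<close> times
  \<open>bsgn A B * bsgn B A\<close>, which is the factor that interchanges \<open>blade_coeff p q A B\<close> and
  \<open>blade_coeff p q B A\<close>.
\<close>

lemma tilde_mult:
  fixes U V :: "'f::field mv"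
  assumes "U \<in> carrier (Cl p q r)" "V \<in> carrier (Cl p q r)"
  shows "tilde (U \<otimes>\<^bsub>Cl p q r\<^esub> V) = tilde V \<otimes>\<^bsub>Cl p q r\<^esub> tilde U"
proof
  fix C
  have "bsgn C C * (blade_coeff p q A B * U A * V B) =
      blade_coeff p q B A * tilde V B * tilde U A"
    if "A \<subseteq> {1..p+q+r}" "B \<subseteq> {1..p+q+r}" "sym_diff A B = C" for A B
  proof -
    have fin: "finite A" "finite B" using that finite_subset by blast+
    have "bsgn C C * bsgn A B = bsgn A A * bsgn B B * bsgn B A * (bsgn A B * bsgn A B :: 'f)"
      unfolding that(3)[symmetric] using fin by (simp add: bsgn_left bsgn_right mult_ac)
    then have "bsgn C C * blade_coeff p q A B = bsgn A A * bsgn B B * (blade_coeff p q B A :: 'f)"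
      unfolding bsgn_square by (simp add: blade_coeff_bsgn fin Int_commute mult.assoc[symmetric])
    then have "bsgn C C * blade_coeff p q A B * (U A * V B) =
        bsgn A A * bsgn B B * blade_coeff p q B A * (U A * V B)" by simp
    then show ?thesis
      unfolding tilde_bsgn[OF assms(1)] tilde_bsgn[OF assms(2)] by (simp only: mult_ac)
  qed
  then show "tilde (U \<otimes>\<^bsub>Cl p q r\<^esub> V) C = (tilde V \<otimes>\<^bsub>Cl p q r\<^esub> tilde U) C"
    unfolding tilde_bsgn[OF Cl_mult_closed] Cl_mult_swap[of _ _ _ "tilde V"]
    by (simp add: Cl_def sum_distrib_left split_def del: atLeastAtMost_iff)
qed

section \<open>Twisted centralizers in coordinates\<close>

text \<open>
  For \<open>e_A\<close> and \<open>e_B\<close> this is the relation \<open>hat e_A e_B = e_B e_A\<close>. A null generator in \<open>A \<inter> B\<close>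
  makes both sides zero; otherwise the two sides differ by a sign, whose exponent collects \<open>card A\<close>
  from the grade involution and \<open>card A * card B + card (A \<inter> B)\<close> from the interchange.
\<close>

definition twisted_commuting :: "nat \<Rightarrow> nat \<Rightarrow> nat set \<Rightarrow> nat set \<Rightarrow> bool" where
  "twisted_commuting p q A B \<longleftrightarrow>
     (\<exists>i\<in>A \<inter> B. p + q < i) \<or> even (card A * (1 + card B) + card (A \<inter> B))"

lemma twisted_commuting_iff_blade_coeff:
  assumes "finite A" "finite B"
  shows "(- 1) ^ card A * blade_coeff p q A B = (blade_coeff p q B A :: 'f::field_char_0) \<longleftrightarrow>
    twisted_commuting p q A B"
proof -
  let ?e = "prod (eta p q) (A \<inter> B) :: 'f"
  have eta0: "eta p q i = (0::'f) \<longleftrightarrow> p + q < i" for i by (simp add: eta_def)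
  have e: "?e = 0 \<longleftrightarrow> (\<exists>i\<in>A \<inter> B. p + q < i)"
    using assms by (simp add: eta0)
  have nz: "bsgn B A \<noteq> (0::'f)" using bsgn_square[of B A, where 'f='f] by auto
  have "bsgn A B = bsgn A B * (bsgn B A * bsgn B A :: 'f)" by (simp add: bsgn_square)
  also have "\<dots> = (- 1) ^ (card A * card B + card (A \<inter> B)) * bsgn B A"
    using bsgn_commute[OF assms, where 'f='f] by (simp add: mult.assoc[symmetric])
  finally have "(- 1) ^ card A * blade_coeff p q A B =
      (- 1) ^ (card A * (1 + card B) + card (A \<inter> B)) * (bsgn B A * ?e)"
    using assms by (simp add: blade_coeff_bsgn power_add)
  moreover have "blade_coeff p q B A = bsgn B A * ?e"
    using assms by (simp add: blade_coeff_bsgn Int_commute)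
  ultimately show ?thesis
    using nz e unfolding twisted_commuting_def by (auto simp: minus_one_power_iff)
qed

lemma twisted_commute_if:
  fixes W V :: "'f::field_char_0 mv"
  assumes "\<And>A B. A \<subseteq> {1..p+q+r} \<Longrightarrow> B \<subseteq> {1..p+q+r} \<Longrightarrow> W A \<noteq> 0 \<Longrightarrow> V B \<noteq> 0 \<Longrightarrow>
    twisted_commuting p q A B"
  shows "hat W \<otimes>\<^bsub>Cl p q r\<^esub> V = V \<otimes>\<^bsub>Cl p q r\<^esub> W"
proof
  fix C
  have "blade_coeff p q A B * hat W A * V B = blade_coeff p q B A * V B * W A"
    if "A \<subseteq> {1..p+q+r}" "B \<subseteq> {1..p+q+r}" for A B
  proof (cases "W A = 0 \<or> V B = 0")
    case False
    have fin: "finite A" "finite B" using that finite_subset by blast+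
    have "(- 1) ^ card A * blade_coeff p q A B = (blade_coeff p q B A :: 'f)"
      using assms[OF that] False twisted_commuting_iff_blade_coeff[OF fin] by blast
    from arg_cong[OF this, of "\<lambda>c. c * (W A * V B)"] show ?thesis
      by (simp add: hat_def mult_ac)
  qed (auto simp: hat_def)
  then show "(hat W \<otimes>\<^bsub>Cl p q r\<^esub> V) C = (V \<otimes>\<^bsub>Cl p q r\<^esub> W) C"
    unfolding Cl_mult_swap[of _ _ _ V]
    by (simp add: Cl_def split_def del: atLeastAtMost_iff) (intro sum.cong; auto)
qed

text \<open>
  As \<open>A \<mapsto> sym_diff A B\<close> is injective, each coordinate of a product with \<open>e_B\<close> comes from a single
  coordinate of \<open>U\<close>. This is what turns a commutation relation with \<open>e_B\<close> into separate conditions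
  on the blades of an element.
\<close>

lemma mult_blade_right:
  fixes U :: "'f::field mv"
  assumes "A \<subseteq> {1..p+q+r}" "B \<subseteq> {1..p+q+r}"
  shows "(U \<otimes>\<^bsub>Cl p q r\<^esub> blade B) (sym_diff A B) = blade_coeff p q A B * U A"
proof -
  have s: "sym_diff A' (sym_diff A B) = B \<longleftrightarrow> A' = A" for A' by blast
  have "(U \<otimes>\<^bsub>Cl p q r\<^esub> blade B) (sym_diff A B) =
    (\<Sum>A'\<in>Pow {1..p+q+r}. if A' = A then blade_coeff p q A B * U A else 0)"
    using assms by (subst Cl_mult_eq, blast, intro sum.cong refl)
      (simp add: blade_def s sym_diff_cancel del: atLeastAtMost_iff)
  then show ?thesis using assms by simp
qed

lemma mult_blade_left:
  fixes U :: "'f::field mv"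
  assumes "A \<subseteq> {1..p+q+r}" "B \<subseteq> {1..p+q+r}"
  shows "(blade B \<otimes>\<^bsub>Cl p q r\<^esub> U) (sym_diff A B) = blade_coeff p q B A * U A"
proof -
  have s: "sym_diff B (sym_diff A B) = A" by blast
  have "(blade B \<otimes>\<^bsub>Cl p q r\<^esub> U) (sym_diff A B) =
    (\<Sum>B'\<in>Pow {1..p+q+r}. if B' = B then blade_coeff p q B A * U A else 0)"
    using assms by (subst Cl_mult_eq, blast, intro sum.cong refl)
      (simp add: blade_def s del: atLeastAtMost_iff)
  then show ?thesis using assms by simp
qed

lemma twisted_commute_blade_iff:
  fixes W :: "'f::field_char_0 mv"
  assumes "B \<subseteq> {1..p+q+r}"
  shows "hat W \<otimes>\<^bsub>Cl p q r\<^esub> blade B = blade B \<otimes>\<^bsub>Cl p q r\<^esub> W \<longleftrightarrow>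
    (\<forall>A\<subseteq>{1..p+q+r}. W A \<noteq> 0 \<longrightarrow> twisted_commuting p q A B)"
proof safe
  fix A
  assume eq: "hat W \<otimes>\<^bsub>Cl p q r\<^esub> blade B = blade B \<otimes>\<^bsub>Cl p q r\<^esub> W"
    and A: "A \<subseteq> {1..p+q+r}" and nz: "W A \<noteq> 0"
  have fin: "finite A" "finite B" using A assms finite_subset by blast+
  have "blade_coeff p q A B * hat W A = blade_coeff p q B A * W A"
    using arg_cong[OF eq, of "\<lambda>X. X (sym_diff A B)"]
    by (simp only: mult_blade_left[OF A assms] mult_blade_right[OF A assms])
  then have "((- 1) ^ card A * blade_coeff p q A B) * W A = blade_coeff p q B A * W A"
    by (simp add: hat_def mult_ac)
  then show "twisted_commuting p q A B"
    using nz twisted_commuting_iff_blade_coeff[OF fin, where 'f='f] by simp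
next
  assume "\<forall>A\<subseteq>{1..p+q+r}. W A \<noteq> 0 \<longrightarrow> twisted_commuting p q A B"
  then show "hat W \<otimes>\<^bsub>Cl p q r\<^esub> blade B = blade B \<otimes>\<^bsub>Cl p q r\<^esub> W"
    by (intro twisted_commute_if) (auto simp: blade_def split: if_splits)
qed

text \<open>
  The sum of the homogeneous subspaces of the grades in \<open>K\<close>. It covers both a single grade and the
  subspaces of quaternion type, which collect grades modulo \<open>4\<close>.
\<close>

definition graded_span :: "nat \<Rightarrow> nat \<Rightarrow> nat \<Rightarrow> nat set \<Rightarrow> 'f::field mv set" where
  "graded_span p q r K = {U \<in> carrier (Cl p q r). \<forall>A. U A \<noteq> 0 \<longrightarrow> card A \<in> K}"

lemma twisted_commute_graded_span_iff:
  fixes W :: "'f::field_char_0 mv"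
  shows "(\<forall>V\<in>graded_span p q r K. hat W \<otimes>\<^bsub>Cl p q r\<^esub> V = V \<otimes>\<^bsub>Cl p q r\<^esub> W) \<longleftrightarrow>
    (\<forall>A\<subseteq>{1..p+q+r}. W A \<noteq> 0 \<longrightarrow>
      (\<forall>B\<subseteq>{1..p+q+r}. card B \<in> K \<longrightarrow> twisted_commuting p q A B))"
proof
  assume L: "\<forall>V\<in>graded_span p q r K. hat W \<otimes>\<^bsub>Cl p q r\<^esub> V = V \<otimes>\<^bsub>Cl p q r\<^esub> W"
  have "blade B \<in> (graded_span p q r K :: 'f mv set)" if "B \<subseteq> {1..p+q+r}" "card B \<in> K" for B
    using that unfolding graded_span_def carrier_Cl_iff blade_def by auto
  with L show "\<forall>A\<subseteq>{1..p+q+r}. W A \<noteq> 0 \<longrightarrow>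
      (\<forall>B\<subseteq>{1..p+q+r}. card B \<in> K \<longrightarrow> twisted_commuting p q A B)"
    using twisted_commute_blade_iff by blast
next
  assume R: "\<forall>A\<subseteq>{1..p+q+r}. W A \<noteq> 0 \<longrightarrow>
      (\<forall>B\<subseteq>{1..p+q+r}. card B \<in> K \<longrightarrow> twisted_commuting p q A B)"
  show "\<forall>V\<in>graded_span p q r K. hat W \<otimes>\<^bsub>Cl p q r\<^esub> V = V \<otimes>\<^bsub>Cl p q r\<^esub> W"
  proof (intro ballI twisted_commute_if)
    fix V :: "'f mv" and A B
    assume "V \<in> graded_span p q r K" "A \<subseteq> {1..p+q+r}" "B \<subseteq> {1..p+q+r}" "W A \<noteq> 0" "V B \<noteq> 0"
    moreover from this have "card B \<in> K" unfolding graded_span_def by simp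
    ultimately show "twisted_commuting p q A B" using R by simp
  qed
qed

text \<open>
  The blades \<open>e_A\<close> that lie in the twisted centralizers of all grades in \<open>K\<close>. These centralizers
  are spanned by blades, so inclusions and equalities between their intersections can be read off
  from these families of sets.
\<close>

definition twisted_support :: "nat \<Rightarrow> nat \<Rightarrow> nat \<Rightarrow> nat set \<Rightarrow> nat set set" where
  "twisted_support p q r K =
     {A. A \<subseteq> {1..p+q+r} \<and> (\<forall>B\<subseteq>{1..p+q+r}. card B \<in> K \<longrightarrow> twisted_commuting p q A B)}"

definition supported_on :: "nat set set \<Rightarrow> 'f::field mv set" where
  "supported_on S = {U. \<forall>A. U A \<noteq> 0 \<longrightarrow> A \<in> S}"

lemma twisted_commute_graded_span_iff_support:
  fixes W :: "'f::field_char_0 mv"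
  assumes "W \<in> carrier (Cl p q r)"
  shows "(\<forall>V\<in>graded_span p q r K. hat W \<otimes>\<^bsub>Cl p q r\<^esub> V = V \<otimes>\<^bsub>Cl p q r\<^esub> W) \<longleftrightarrow>
    W \<in> supported_on (twisted_support p q r K)"
  using assms unfolding twisted_commute_graded_span_iff supported_on_def twisted_support_def carrier_Cl_iff
    mem_Collect_eq by metis

lemma twisted_support_Un:
  "twisted_support p q r (K \<union> L) = twisted_support p q r K \<inter> twisted_support p q r L"
  unfolding twisted_support_def by blast

lemma twisted_support_subset: "A \<in> twisted_support p q r K \<Longrightarrow> A \<subseteq> {1..p+q+r}"
  unfolding twisted_support_def by blast

lemma twisted_supportD:
  "A \<in> twisted_support p q r K \<Longrightarrow> C \<subseteq> {1..p+q+r} \<Longrightarrow> card C \<in> K \<Longrightarrow> twisted_commuting p q A C"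
  unfolding twisted_support_def by blast

lemma twisted_supportI:
  assumes "A \<subseteq> {1..p+q+r}"
    and "\<And>B. B \<subseteq> {1..p+q+r} \<Longrightarrow> card B \<in> K \<Longrightarrow> twisted_commuting p q A B"
  shows "A \<in> twisted_support p q r K"
  using assms unfolding twisted_support_def by blast

lemma twisted_support_antimono:
  "K \<subseteq> L \<Longrightarrow> twisted_support p q r L \<subseteq> twisted_support p q r K"
  unfolding twisted_support_def by blast

lemma supported_on_Int: "supported_on (S \<inter> T) = supported_on S \<inter> supported_on T"
  unfolding supported_on_def by blast

lemma twisted_centralizer_eq:
  "(twisted_centralizer p q r m :: 'f::field_char_0 mv set) =
    supported_on (twisted_support p q r {m})"
proof -
  have g: "(grade p q r m :: 'f mv set) = graded_span p q r {m}"
    by (simp add: grade_def graded_span_def)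
  have "supported_on (twisted_support p q r {m}) \<subseteq> carrier (Cl p q r :: ('f, 'f mv) module)"
    unfolding supported_on_def twisted_support_def Cl_def partial_object.simps by blast
  then show ?thesis
    unfolding twisted_centralizer_def g using twisted_commute_graded_span_iff_support by blast
qed

lemma twisted_centralizer_Int:
  "(twisted_centralizer p q r k \<inter> twisted_centralizer p q r l :: 'f::field_char_0 mv set) =
    supported_on (twisted_support p q r {k, l})"
  unfolding twisted_centralizer_eq supported_on_Int[symmetric] twisted_support_Un[symmetric]
  by (simp add: insert_commute)

text \<open>
  Grade \<open>0\<close> consists of the multiples of the unit, so the twisted centralizer of grade \<open>0\<close> is the
  fixed space of the grade involution.
\<close>

lemma even_part_eq:
  "(even_part p q r :: 'f::field_char_0 mv set) = twisted_centralizer p q r 0"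
proof -
  have "A \<in> twisted_support p q r {0} \<longleftrightarrow> A \<subseteq> {1..p+q+r} \<and> even (card A)" for A
  proof -
    have "B \<subseteq> {1..p+q+r} \<and> card B = 0 \<longleftrightarrow> B = {}" for B
      using finite_subset[of B "{1..p+q+r}"] by auto
    then have "A \<in> twisted_support p q r {0} \<longleftrightarrow> A \<subseteq> {1..p+q+r} \<and> twisted_commuting p q A {}"
      unfolding twisted_support_def mem_Collect_eq singleton_iff by metis
    then show ?thesis by (simp add: twisted_commuting_def)
  qed
  then show ?thesis
    unfolding twisted_centralizer_eq even_part_def supported_on_def carrier_Cl_iff by blast
qed

lemma hat_even: "U \<in> even_part p q r \<Longrightarrow> hat U = U"
  unfolding even_part_def hat_def fun_eq_iff by (auto simp: minus_one_power_iff)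

lemma centralizer_even_eq:
  "(centralizer p q r m \<inter> even_part p q r :: 'f::field_char_0 mv set) =
    supported_on (twisted_support p q r {0, m})"
proof -
  have "(centralizer p q r m \<inter> even_part p q r :: 'f mv set) =
      even_part p q r \<inter> twisted_centralizer p q r m"
    unfolding centralizer_def twisted_centralizer_def by (auto simp: hat_even[of _ p q r])
  then show ?thesis unfolding even_part_eq twisted_centralizer_Int .
qed

section \<open>Two grades decide\<close>

text \<open>
  If \<open>A \<inter> B\<close> is a singleton, two elements of \<open>B - A\<close> are added to it; otherwise it has at least
  three elements, and any three of them will do.
\<close>

lemma odd_Int_3_subset:
  assumes "finite B" "3 \<le> card B" "odd (card (A \<inter> B))"
  shows "\<exists>C\<subseteq>B. card C = 3 \<and> odd (card (A \<inter> C))"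
proof (cases "card (A \<inter> B) = 1")
  case True
  have "card (B - A) = card B - card (A \<inter> B)"
    using card_Diff_subset_Int[of B A] assms(1) by (simp add: Int_commute)
  then have "2 \<le> card (B - A)" using True assms by simp
  then obtain D where D: "D \<subseteq> B - A" "card D = 2" "finite D" using obtain_subset_with_card_n by metis
  have "A \<inter> ((A \<inter> B) \<union> D) = A \<inter> B" using D by blast
  moreover have "card ((A \<inter> B) \<union> D) = 3"
    using D assms True by (subst card_Un_disjoint) auto
  ultimately show ?thesis using D assms(3) by (intro exI[of _ "(A \<inter> B) \<union> D"]) auto
next
  case False
  then have "3 \<le> card (A \<inter> B)" using assms(3) by presburger
  then obtain C where C: "C \<subseteq> A \<inter> B" "card C = 3" using obtain_subset_with_card_n by metis
  then have "A \<inter> C = C" by blast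
  then show ?thesis using C by (intro exI[of _ C]) auto
qed

lemma twisted_commuting_subset:
  assumes "twisted_commuting p q A C" "C \<subseteq> B" "\<not> (\<exists>i\<in>A \<inter> B. p + q < i)"
  shows "even (card A * (1 + card C) + card (A \<inter> C))"
  using assms unfolding twisted_commuting_def by blast

text \<open>
  Suppose that \<open>A \<inter> B\<close> contains no null generator. The singletons in \<open>B\<close> force \<open>A \<inter> B = {}\<close>, and then
  a pair in \<open>B\<close> forces \<open>card A\<close> to be even.
\<close>

lemma twisted_support_12: "twisted_support p q r {m. m mod 4 \<in> {1, 2}} = twisted_support p q r {1, 2}"
proof
  show "twisted_support p q r {m. m mod 4 \<in> {1, 2}} \<subseteq> twisted_support p q r {1, 2}"
    by (rule twisted_support_antimono) auto
  show "twisted_support p q r {1, 2} \<subseteq> twisted_support p q r {m. m mod 4 \<in> {1, 2}}"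
  proof
    fix A assume *: "A \<in> twisted_support p q r {1, 2}"
    note A = twisted_support_subset[OF *] and tw = twisted_supportD[OF *]
    have "twisted_commuting p q A B" if B: "B \<subseteq> {1..p+q+r}" "card B mod 4 \<in> {1, 2}" for B
    proof (cases "\<exists>i\<in>A \<inter> B. p + q < i")
      case False
      have disj: "A \<inter> B = {}"
      proof (rule ccontr)
        assume "A \<inter> B \<noteq> {}"
        then obtain b where b: "b \<in> A" "b \<in> B" by blast
        then have "even (card A * (1 + card {b}) + card (A \<inter> {b}))"
          using tw[of "{b}"] B by (intro twisted_commuting_subset[OF _ _ False]) auto
        then show False using b by simp
      qed
      show ?thesis
      proof (cases "card B = 1")
        case True
        then show ?thesis using tw B by simp
      next
        case F: False
        then have "2 \<le> card B" using B(2) by (cases "card B = 0") auto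
        then obtain C where C: "C \<subseteq> B" "card C = 2" using obtain_subset_with_card_n by metis
        then have "even (card A * (1 + card C) + card (A \<inter> C))"
          using tw[of C] B by (intro twisted_commuting_subset[OF _ _ False]) auto
        moreover have "A \<inter> C = {}" using disj C by blast
        ultimately have "even (card A)" using C by simp
        then show ?thesis unfolding twisted_commuting_def disj by simp
      qed
    next
      case True
      then show ?thesis unfolding twisted_commuting_def by blast
    qed
    then show "A \<in> twisted_support p q r {m. m mod 4 \<in> {1, 2}}"
      by (intro twisted_supportI[OF A]) (simp only: mem_Collect_eq)
  qed
qed

lemma twisted_commuting_even_null:
  assumes "A \<subseteq> {p+q+1..p+q+r}" "even (card A)"
  shows "twisted_commuting p q A B"
proof (cases "A \<inter> B = {}")
  case True
  then show ?thesis using assms(2) unfolding twisted_commuting_def by simp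
next
  case False
  then obtain i where "i \<in> A \<inter> B" by blast
  moreover from this have "p + q < i" using assms(1) by auto
  ultimately show ?thesis unfolding twisted_commuting_def by blast
qed

text \<open>
  The empty set forces \<open>card A\<close> to be even, and the singletons force every element of \<open>A\<close> to be a
  null generator: the even centre is the even part of the Grassmann subalgebra.
\<close>

lemma twisted_support_01_iff:
  "A \<in> twisted_support p q r {0, 1} \<longleftrightarrow> A \<subseteq> {p+q+1..p+q+r} \<and> even (card A)"
proof
  assume *: "A \<in> twisted_support p q r {0, 1}"
  note A = twisted_support_subset[OF *] and tw = twisted_supportD[OF *]
  have "p + q < a" if "a \<in> A" for a
    using tw[of "{a}"] that A unfolding twisted_commuting_def by auto
  then have "A \<subseteq> {p+q+1..p+q+r}" using A by fastforce
  then show "A \<subseteq> {p+q+1..p+q+r} \<and> even (card A)"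
    using tw[of "{}"] unfolding twisted_commuting_def by simp
next
  assume A: "A \<subseteq> {p+q+1..p+q+r} \<and> even (card A)"
  then have "A \<subseteq> {1..p+q+r}" by fastforce
  then show "A \<in> twisted_support p q r {0, 1}"
    using A twisted_commuting_even_null unfolding twisted_support_def by blast
qed

lemma twisted_support_01_subset: "twisted_support p q r {0, 1} \<subseteq> twisted_support p q r K"
proof
  fix A assume A: "A \<in> twisted_support p q r {0, 1}"
  then have "twisted_commuting p q A B" for B
    unfolding twisted_support_01_iff using twisted_commuting_even_null by blast
  with A show "A \<in> twisted_support p q r K" unfolding twisted_support_def by blast
qed

lemma twisted_support_01: "twisted_support p q r {m. m mod 4 \<in> {0, 1}} = twisted_support p q r {0, 1}"
proof
  show "twisted_support p q r {m. m mod 4 \<in> {0, 1}} \<subseteq> twisted_support p q r {0, 1}"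
    by (rule twisted_support_antimono) auto
qed (rule twisted_support_01_subset)

text \<open>
  For even \<open>card A\<close> the parity is that of \<open>A \<inter> B\<close> alone, so \<open>odd_Int_3_subset\<close> carries a
  violation from \<open>B\<close> down to a subset with three elements.
\<close>

lemma even_commuting_of_3:
  assumes "finite B" "3 \<le> card B" "even (card A)" "\<not> (\<exists>i\<in>A \<inter> B. p + q < i)"
    and "\<And>C. C \<subseteq> B \<Longrightarrow> card C = 3 \<Longrightarrow> twisted_commuting p q A C"
  shows "twisted_commuting p q A B"
proof (rule ccontr)
  assume "\<not> twisted_commuting p q A B"
  then have "odd (card (A \<inter> B))" using assms(3) unfolding twisted_commuting_def by auto
  then obtain C where C: "C \<subseteq> B" "card C = 3" "odd (card (A \<inter> C))"
    using odd_Int_3_subset[OF assms(1,2)] by metis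
  have "even (card A * (1 + card C) + card (A \<inter> C))"
    by (rule twisted_commuting_subset[OF assms(5)[OF C(1,2)] C(1) assms(4)])
  then show False using C assms(3) by simp
qed

lemma twisted_support_03: "twisted_support p q r {m. m mod 4 \<in> {0, 3}} = twisted_support p q r {0, 3}"
proof
  show "twisted_support p q r {m. m mod 4 \<in> {0, 3}} \<subseteq> twisted_support p q r {0, 3}"
    by (rule twisted_support_antimono) auto
  show "twisted_support p q r {0, 3} \<subseteq> twisted_support p q r {m. m mod 4 \<in> {0, 3}}"
  proof
    fix A assume *: "A \<in> twisted_support p q r {0, 3}"
    note A = twisted_support_subset[OF *] and tw = twisted_supportD[OF *]
    have ev: "even (card A)" using tw[of "{}"] unfolding twisted_commuting_def by simp
    have "twisted_commuting p q A B" if B: "B \<subseteq> {1..p+q+r}" "card B mod 4 \<in> {0, 3}" for B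
    proof (cases "(\<exists>i\<in>A \<inter> B. p + q < i) \<or> card B = 0")
      case False
      have c3: "3 \<le> card B" using False B(2) by (cases "card B < 3") auto
      show ?thesis
      proof (rule even_commuting_of_3[OF _ c3 ev])
        show "finite B" using B(1) finite_subset by blast
        show "\<not> (\<exists>i\<in>A \<inter> B. p + q < i)" using False by blast
        show "twisted_commuting p q A C" if "C \<subseteq> B" "card C = 3" for C
          using tw[of C] that B(1) by blast
      qed
    next
      case True
      then show ?thesis using tw[OF B(1)] unfolding twisted_commuting_def[of p q A B] by blast
    qed
    then show "A \<in> twisted_support p q r {m. m mod 4 \<in> {0, 3}}"
      by (intro twisted_supportI[OF A]) (simp only: mem_Collect_eq)
  qed
qed

text \<open>
  For even \<open>card A\<close> the argument is that of \<open>even_commuting_of_3\<close>. For odd \<open>card A\<close> and a set \<open>B\<close>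
  with at least three elements that meets \<open>A\<close> in no null generator, every pair in \<open>B\<close> would have
  exactly one element in \<open>A\<close>, but among three elements two lie on the same side of \<open>A\<close>.
\<close>

lemma twisted_support_23: "twisted_support p q r {m. m mod 4 \<in> {2, 3}} = twisted_support p q r {2, 3}"
proof
  show "twisted_support p q r {m. m mod 4 \<in> {2, 3}} \<subseteq> twisted_support p q r {2, 3}"
    by (rule twisted_support_antimono) auto
  show "twisted_support p q r {2, 3} \<subseteq> twisted_support p q r {m. m mod 4 \<in> {2, 3}}"
  proof
    fix A assume *: "A \<in> twisted_support p q r {2, 3}"
    note A = twisted_support_subset[OF *] and tw = twisted_supportD[OF *]
    have "twisted_commuting p q A B" if B: "B \<subseteq> {1..p+q+r}" "card B mod 4 \<in> {2, 3}" for B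
    proof (cases "(\<exists>i\<in>A \<inter> B. p + q < i) \<or> card B = 2")
      case False
      then have nn: "\<not> (\<exists>i\<in>A \<inter> B. p + q < i)" by blast
      have c3: "3 \<le> card B"
      proof -
        have "card B \<noteq> 2" "card B mod 4 = 2 \<or> card B mod 4 = 3" using False B(2) by auto
        then show ?thesis by presburger
      qed
      have ev: "even (card A)"
      proof (rule ccontr)
        assume od: "odd (card A)"
        obtain D where D: "D \<subseteq> B" "card D = 3" using c3 obtain_subset_with_card_n by metis
        then obtain x y z where xyz: "D = {x, y, z}" "x \<noteq> y" "y \<noteq> z" "x \<noteq> z"
          unfolding card_3_iff by metis
        have pair: "(u \<in> A) \<noteq> (v \<in> A)" if "u \<in> B" "v \<in> B" "u \<noteq> v" for u v
        proof -
          have "{u, v} \<subseteq> {1..p+q+r}" using that B(1) by blast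
          then have "twisted_commuting p q A {u, v}" using tw[of "{u, v}"] that(3) by simp
          then have "even (card A * (1 + card {u, v}) + card (A \<inter> {u, v}))"
            using that by (intro twisted_commuting_subset[OF _ _ nn]) auto
          then have "odd (card (A \<inter> {u, v}))" using od that by simp
          moreover have "A \<inter> {u, v} = (if u \<in> A then {u} else {}) \<union> (if v \<in> A then {v} else {})" by auto
          ultimately show ?thesis using that(3) by (cases "u \<in> A"; cases "v \<in> A") simp_all
        qed
        show False using pair[of x y] pair[of y z] pair[of x z] xyz D(1) by blast
      qed
      show ?thesis
      proof (rule even_commuting_of_3[OF _ c3 ev nn])
        show "finite B" using B(1) finite_subset by blast
        show "twisted_commuting p q A C" if "C \<subseteq> B" "card C = 3" for C
          using tw[of C] that B(1) by blast
      qed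
    next
      case True
      then show ?thesis using tw[OF B(1)] unfolding twisted_commuting_def[of p q A B] by blast
    qed
    then show "A \<in> twisted_support p q r {m. m mod 4 \<in> {2, 3}}"
      by (intro twisted_supportI[OF A]) (simp only: mem_Collect_eq)
  qed
qed

lemma Grassmann_even_eq:
  "(Grassmann_even p q r :: 'f::field mv set) = supported_on (twisted_support p q r {0, 1})"
proof -
  have "{p+q+1..p+q+r} \<subseteq> {1..p+q+r}" by auto
  then show ?thesis
    unfolding Grassmann_even_def Grassmann_def even_part_def supported_on_def
      twisted_support_01_iff carrier_Cl_iff by blast
qed

section \<open>Grades modulo four\<close>

lemma even_triangular_iff:
  fixes m :: nat
  shows "even (m * (m - 1) div 2) \<longleftrightarrow> m mod 4 \<in> {0, 1}"
proof -
  define d where "d = m div 4"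
  have m: "m = 4 * d + m mod 4" unfolding d_def by simp
  have "m mod 4 = 0 \<or> m mod 4 = 1 \<or> m mod 4 = 2 \<or> m mod 4 = 3" by linarith
  then show ?thesis
  proof (elim disjE)
    assume r: "m mod 4 = 0"
    then have "m * (m - 1) div 2 = 2 * (d * (m - 1))" using m by simp
    then show ?thesis using r by simp
  next
    assume r: "m mod 4 = 1"
    then have m': "m = 4 * d + 1" using m by simp
    have "m * (m - 1) = 2 * (2 * (d * (4 * d + 1)))" unfolding m' by (simp add: algebra_simps)
    then have "m * (m - 1) div 2 = 2 * (d * (4 * d + 1))" by simp
    then show ?thesis using r by simp
  next
    assume r: "m mod 4 = 2"
    then have m': "m = 4 * d + 2" using m by simp
    have "m * (m - 1) = 2 * (2 * (4 * d * d + 3 * d) + 1)" unfolding m' by (simp add: algebra_simps)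
    then have "m * (m - 1) div 2 = 2 * (4 * d * d + 3 * d) + 1" by simp
    then show ?thesis using r by simp
  next
    assume r: "m mod 4 = 3"
    then have m': "m = 4 * d + 3" using m by simp
    have "m * (m - 1) = 2 * (2 * (4 * d * d + 5 * d + 1) + 1)" unfolding m' by (simp add: algebra_simps)
    then have "m * (m - 1) div 2 = 2 * (4 * d * d + 5 * d + 1) + 1" by simp
    then show ?thesis using r by simp
  qed
qed
text \<open>
  The first sign determines \<open>c\<close> modulo \<open>2\<close>, and the second one then determines it modulo \<open>4\<close>.
\<close>

lemma sign_pair_mod_4:
  "(- 1 :: 'f::field_char_0) ^ c = (- 1) ^ k \<and>
   (- 1 :: 'f) ^ (c * (c - 1) div 2) = (- 1) ^ (k * (k - 1) div 2) \<longleftrightarrow> c mod 4 = k mod 4"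
proof -
  have pow: "(- 1 :: 'f) ^ a = (- 1) ^ b \<longleftrightarrow> (even a \<longleftrightarrow> even b)" for a b
    by (simp add: minus_one_power_iff)
  show ?thesis unfolding pow even_triangular_iff by simp presburger
qed

lemma qtype_eq:
  "(qtype p q r k :: 'f::field_char_0 mv set) = graded_span p q r {m. m mod 4 = k mod 4}"
proof -
  have s: "(c \<odot>\<^bsub>Cl p q r\<^esub> U) A = c * U A" for c :: 'f and U :: "'f mv" and A
    by (simp add: Cl_def)
  show ?thesis
    unfolding qtype_def graded_span_def fun_eq_iff hat_def tilde_def s
    by (auto simp: sign_pair_mod_4[where 'f='f, symmetric])
qed

lemma qtype2_eq:
  "(qtype2 p q r k l :: 'f::field_char_0 mv set) =
    graded_span p q r {m. m mod 4 \<in> {k mod 4, l mod 4}}"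
proof
  show "qtype2 p q r k l \<subseteq> (graded_span p q r {m. m mod 4 \<in> {k mod 4, l mod 4}} :: 'f mv set)"
  proof
    fix U :: "'f mv"
    assume "U \<in> qtype2 p q r k l"
    then obtain X Y where XY: "X \<in> qtype p q r k" "Y \<in> qtype p q r l" "U = X \<oplus>\<^bsub>Cl p q r\<^esub> Y"
      unfolding qtype2_def set_add_def' by blast
    have nz: "X A \<noteq> 0 \<or> Y A \<noteq> 0" if "U A \<noteq> 0" for A
      using that XY(3) by (auto simp: Cl_def)
    show "U \<in> graded_span p q r {m. m mod 4 \<in> {k mod 4, l mod 4}}"
      using nz XY(1,2) unfolding qtype_eq graded_span_def carrier_Cl_iff by blast
  qed
  show "(graded_span p q r {m. m mod 4 \<in> {k mod 4, l mod 4}} :: 'f mv set) \<subseteq> qtype2 p q r k l"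
  proof
    fix U :: "'f mv"
    assume U: "U \<in> graded_span p q r {m. m mod 4 \<in> {k mod 4, l mod 4}}"
    define X where "X = (\<lambda>A. if card A mod 4 = k mod 4 then U A else 0)"
    define Y where "Y = (\<lambda>A. if card A mod 4 = k mod 4 then 0 else U A)"
    have "X \<in> qtype p q r k" "Y \<in> qtype p q r l"
      using U unfolding qtype_eq graded_span_def carrier_Cl_iff X_def Y_def by auto
    moreover have "U = X \<oplus>\<^bsub>Cl p q r\<^esub> Y"
      by (auto simp: Cl_def X_def Y_def)
    ultimately show "U \<in> qtype2 p q r k l"
      unfolding qtype2_def set_add_def' by blast
  qed
qed

section \<open>Invertibility\<close>

text \<open>
  The whole space may have infinite dimension, as the type of multivectors does; only the span of
  \<open>B\<close> is finite-dimensional. A vector of the span outside the image could be added to the image of a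
  basis, giving more independent vectors than the dimension permits.
\<close>

lemma (in vector_space) injective_on_finite_span_imp_surjective:
  assumes f: "Vector_Spaces.linear scale scale f" and B: "finite B"
    and maps: "f ` span B \<subseteq> span B" and inj: "inj_on f (span B)"
  shows "f ` span B = span B"
proof -
  interpret f: Vector_Spaces.linear scale scale f by (rule f)
  obtain I where I: "I \<subseteq> B" "independent I" "B \<subseteq> span I"
    using maximal_independent_subset by blast
  have sp: "span I = span B"
    using I by (meson span_mono span_minimal subspace_span subset_antisym)
  have fin: "finite I" using I(1) B finite_subset by blast
  have inj': "inj_on f (span I)" using inj sp by simp
  have ind: "independent (f ` I)"
    using f.independent_injective_image[OF I(2) inj'] .
  have card: "card (f ` I) = card I"
    using card_image[OF inj_on_subset[OF inj' span_superset]] .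
  have sub: "f ` I \<subseteq> span I" using maps sp span_superset[of I] by blast
  have "y \<in> f ` span B" if y: "y \<in> span B" for y
  proof (rule ccontr)
    assume n: "y \<notin> f ` span B"
    then have ny: "y \<notin> span (f ` I)" using f.span_image[of I] sp by simp
    then have "independent (insert y (f ` I))" using ind by (rule independent_insertI)
    moreover have "insert y (f ` I) \<subseteq> span I" using sub y sp by simp
    ultimately have "card (insert y (f ` I)) \<le> card I"
      using independent_span_bound[OF fin] by blast
    moreover have "y \<notin> f ` I" using ny span_base by blast
    ultimately show False using card fin by simp
  qed
  then show ?thesis using maps by blast
qed

text \<open>
  A left inverse of \<open>T\<close> makes left multiplication by \<open>T\<close> injective. As the algebra has finite
  dimension, this map is onto, and a preimage of the unit is a right inverse.
\<close>

lemma Cl_left_invertible_Units: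
  fixes S T :: "'f::field mv"
  assumes T: "T \<in> carrier (Cl p q r)" and S: "S \<in> carrier (Cl p q r)"
    and ST: "S \<otimes>\<^bsub>Cl p q r\<^esub> T = \<one>\<^bsub>Cl p q r\<^esub>"
  shows "T \<in> Units (Cl p q r)"
proof -
  interpret R: ring "Cl p q r :: ('f, 'f mv) module" by (rule Cl_ring)
  define sc where "sc = (\<lambda>(c::'f) (U::'f mv) A. c * U A)"
  have sc: "c \<odot>\<^bsub>Cl p q r\<^esub> U = sc c U" for c U by (simp add: Cl_def sc_def)
  have add: "U \<oplus>\<^bsub>Cl p q r\<^esub> V = U + V" for U V :: "'f mv" by (simp add: Cl_def fun_eq_iff)
  interpret V: vector_space sc
    by unfold_locales (auto simp: sc_def fun_eq_iff algebra_simps)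
  define B where "B = (blade :: nat set \<Rightarrow> 'f mv) ` Pow {1..p+q+r}"
  have span: "V.span B = carrier (Cl p q r)"
  proof
    have "V.subspace (carrier (Cl p q r))"
    proof (rule V.subspaceI)
      fix X Y :: "'f mv"
      assume XY: "X \<in> carrier (Cl p q r)" "Y \<in> carrier (Cl p q r)"
      have "X A \<noteq> 0 \<or> Y A \<noteq> 0" if "(X + Y) A \<noteq> 0" for A using that by auto
      with XY show "X + Y \<in> carrier (Cl p q r)" unfolding carrier_Cl_iff by blast
    qed (auto simp: carrier_Cl_iff sc_def)
    moreover have "B \<subseteq> carrier (Cl p q r)"
      unfolding B_def by (auto simp: carrier_Cl_iff blade_def simp del: atLeastAtMost_iff)
    ultimately show "V.span B \<subseteq> carrier (Cl p q r)" by (rule V.span_minimal[rotated])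
    show "carrier (Cl p q r) \<subseteq> V.span B"
    proof
      fix U :: "'f mv" assume U: "U \<in> carrier (Cl p q r)"
      have app: "(\<Sum>A\<in>F. sc (U A) (blade A)) C = (\<Sum>A\<in>F. sc (U A) (blade A) C)"
        if "finite F" for F C using that by induction auto
      have "U = (\<Sum>A\<in>Pow {1..p+q+r}. sc (U A) (blade A))"
      proof
        fix C
        have "(\<Sum>A\<in>Pow {1..p+q+r}. sc (U A) (blade A) C) =
            (\<Sum>A\<in>Pow {1..p+q+r}. if A = C then U C else 0)"
          by (intro sum.cong) (auto simp: sc_def blade_def)
        also have "\<dots> = U C" using U unfolding carrier_Cl_iff by auto
        finally show "U C = (\<Sum>A\<in>Pow {1..p+q+r}. sc (U A) (blade A)) C"
          by (subst app) auto
      qed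
      moreover have "(\<Sum>A\<in>Pow {1..p+q+r}. sc (U A) (blade A)) \<in> V.span B"
        by (intro V.span_sum V.span_scale V.span_base) (auto simp: B_def)
      ultimately show "U \<in> V.span B" by simp
    qed
  qed
  let ?f = "\<lambda>X. T \<otimes>\<^bsub>Cl p q r\<^esub> X"
  have "module_hom sc sc ?f"
    by unfold_locales (simp_all add: Cl_distrib(2) Cl_smult_mult(2) flip: add sc)
  then have lin: "Vector_Spaces.linear sc sc ?f" by (simp add: module_hom_iff_linear)
  have "inj_on ?f (carrier (Cl p q r))"
  proof (rule inj_onI)
    fix X Y assume "X \<in> carrier (Cl p q r)" "Y \<in> carrier (Cl p q r)"
      "T \<otimes>\<^bsub>Cl p q r\<^esub> X = T \<otimes>\<^bsub>Cl p q r\<^esub> Y"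
    then show "X = Y" using ST Cl_mult_assoc[of p q r S T] Cl_one_left by metis
  qed
  moreover have "?f ` carrier (Cl p q r) \<subseteq> carrier (Cl p q r)" using Cl_mult_closed by blast
  moreover have "finite B" by (simp add: B_def)
  ultimately have "?f ` carrier (Cl p q r) = carrier (Cl p q r)"
    using V.injective_on_finite_span_imp_surjective[OF lin, of B] unfolding span by blast
  then have "\<one>\<^bsub>Cl p q r\<^esub> \<in> ?f ` carrier (Cl p q r)" using R.one_closed by simp
  then obtain X where X: "X \<in> carrier (Cl p q r)" "T \<otimes>\<^bsub>Cl p q r\<^esub> X = \<one>\<^bsub>Cl p q r\<^esub>"
    by auto
  then have "S = X" using ST S Cl_mult_assoc[of p q r S T X] Cl_one_left[OF X(1)] Cl_one_right[OF S] by simp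
  then show ?thesis using X ST T S unfolding Units_def by blast
qed

lemma Units_of_left_factor:
  fixes S T :: "'f::field mv"
  assumes T: "T \<in> carrier (Cl p q r)" and U: "S \<otimes>\<^bsub>Cl p q r\<^esub> T \<in> Units (Cl p q r)"
  shows "T \<in> Units (Cl p q r)"
proof -
  obtain X where "X \<otimes>\<^bsub>Cl p q r\<^esub> (S \<otimes>\<^bsub>Cl p q r\<^esub> T) = \<one>\<^bsub>Cl p q r\<^esub>"
    using U unfolding Units_def by blast
  then have "(X \<otimes>\<^bsub>Cl p q r\<^esub> S) \<otimes>\<^bsub>Cl p q r\<^esub> T = \<one>\<^bsub>Cl p q r\<^esub>" by (simp add: Cl_mult_assoc)
  then show ?thesis by (rule Cl_left_invertible_Units[OF T Cl_mult_closed])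
qed

section \<open>Twisted conjugation and norm functions\<close>

text \<open>
  What the reversion and the Clifford conjugation have in common; the two are exchanged by composing
  with \<open>hat\<close>.
\<close>

locale Cl_reversal =
  fixes p q r :: nat and \<sigma> :: "'f::field_char_0 mv \<Rightarrow> 'f mv"
  assumes closed: "U \<in> carrier (Cl p q r) \<Longrightarrow> \<sigma> U \<in> carrier (Cl p q r)"
    and one: "\<sigma> \<one>\<^bsub>Cl p q r\<^esub> = \<one>\<^bsub>Cl p q r\<^esub>"
    and anti: "U \<in> carrier (Cl p q r) \<Longrightarrow> V \<in> carrier (Cl p q r) \<Longrightarrow>
      \<sigma> (U \<otimes>\<^bsub>Cl p q r\<^esub> V) = \<sigma> V \<otimes>\<^bsub>Cl p q r\<^esub> \<sigma> U"
    and hat_comm: "\<sigma> (hat U) = hat (\<sigma> U)"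
begin

sublocale R: ring "Cl p q r :: ('f, 'f mv) module" by (rule Cl_ring)

lemma Units_image:
  assumes "T \<in> Units (Cl p q r)"
  shows "\<sigma> T \<in> Units (Cl p q r)" "hat T \<in> Units (Cl p q r)"
proof -
  obtain X where X: "X \<in> carrier (Cl p q r)" "T \<in> carrier (Cl p q r)"
    "X \<otimes>\<^bsub>Cl p q r\<^esub> T = \<one>\<^bsub>Cl p q r\<^esub>" "T \<otimes>\<^bsub>Cl p q r\<^esub> X = \<one>\<^bsub>Cl p q r\<^esub>"
    using assms unfolding Units_def by blast
  have "\<sigma> X \<otimes>\<^bsub>Cl p q r\<^esub> \<sigma> T = \<one>\<^bsub>Cl p q r\<^esub>" "\<sigma> T \<otimes>\<^bsub>Cl p q r\<^esub> \<sigma> X = \<one>\<^bsub>Cl p q r\<^esub>"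
    using X anti[of X T] anti[of T X] one by simp_all
  then show "\<sigma> T \<in> Units (Cl p q r)" using X closed unfolding Units_def by blast
  have "hat X \<otimes>\<^bsub>Cl p q r\<^esub> hat T = \<one>\<^bsub>Cl p q r\<^esub>" "hat T \<otimes>\<^bsub>Cl p q r\<^esub> hat X = \<one>\<^bsub>Cl p q r\<^esub>"
    using X hat_one by (simp_all flip: hat_mult)
  then show "hat T \<in> Units (Cl p q r)" using X hat_closed unfolding Units_def by blast
qed

text \<open>
  With \<open>Y = \<sigma> (inv T) V hat (\<sigma> T)\<close> one has \<open>\<sigma> X = c Y\<close>, so the eigenvector equation for \<open>X\<close> is
  \<open>Y = X\<close>. Multiplying by the units \<open>\<sigma> T\<close> and \<open>T\<close> from the left and from the right turns \<open>Y\<close> into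
  \<open>V W\<close> and \<open>X\<close> into \<open>\<sigma> T hat T V\<close>, which is \<open>hat W V\<close>.
\<close>

lemma conjugate_eigenvector_iff:
  assumes T: "T \<in> Units (Cl p q r)" and V: "V \<in> carrier (Cl p q r)"
    and eig: "\<sigma> V = c \<odot>\<^bsub>Cl p q r\<^esub> V" and c: "c \<noteq> 0"
  defines "W \<equiv> hat (\<sigma> T) \<otimes>\<^bsub>Cl p q r\<^esub> T"
    and "X \<equiv> hat T \<otimes>\<^bsub>Cl p q r\<^esub> V \<otimes>\<^bsub>Cl p q r\<^esub> inv\<^bsub>Cl p q r\<^esub> T"
  shows "\<sigma> X = c \<odot>\<^bsub>Cl p q r\<^esub> X \<longleftrightarrow> hat W \<otimes>\<^bsub>Cl p q r\<^esub> V = V \<otimes>\<^bsub>Cl p q r\<^esub> W"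
proof -
  let ?i = "inv\<^bsub>Cl p q r\<^esub> T"
  have Tc: "T \<in> carrier (Cl p q r)" "?i \<in> carrier (Cl p q r)" "hat T \<in> carrier (Cl p q r)"
    "\<sigma> T \<in> carrier (Cl p q r)" "\<sigma> ?i \<in> carrier (Cl p q r)" "hat (\<sigma> T) \<in> carrier (Cl p q r)"
    using T by (auto intro: closed hat_closed)
  have cancel: "c \<odot>\<^bsub>Cl p q r\<^esub> Y = c \<odot>\<^bsub>Cl p q r\<^esub> Z \<longleftrightarrow> Y = Z" for Y Z :: "'f mv"
    using c by (simp add: Cl_def fun_eq_iff)
  have inv1: "\<sigma> T \<otimes>\<^bsub>Cl p q r\<^esub> \<sigma> ?i = \<one>\<^bsub>Cl p q r\<^esub>"
    using anti[of ?i T] Tc T one by simp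
  have Xc: "X \<in> carrier (Cl p q r)" unfolding X_def by (rule Cl_mult_closed)
  have "\<sigma> X = \<sigma> ?i \<otimes>\<^bsub>Cl p q r\<^esub> (\<sigma> V \<otimes>\<^bsub>Cl p q r\<^esub> hat (\<sigma> T))"
    unfolding X_def using Tc V by (simp add: anti hat_comm)
  then have sX: "\<sigma> X = c \<odot>\<^bsub>Cl p q r\<^esub> (\<sigma> ?i \<otimes>\<^bsub>Cl p q r\<^esub> (V \<otimes>\<^bsub>Cl p q r\<^esub> hat (\<sigma> T)))"
    unfolding eig by (simp add: Cl_smult_mult)
  define Y where "Y = \<sigma> ?i \<otimes>\<^bsub>Cl p q r\<^esub> (V \<otimes>\<^bsub>Cl p q r\<^esub> hat (\<sigma> T))"
  have Yc: "Y \<in> carrier (Cl p q r)" unfolding Y_def by (rule Cl_mult_closed)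
  have "\<sigma> X = c \<odot>\<^bsub>Cl p q r\<^esub> X \<longleftrightarrow> Y = X"
    unfolding sX Y_def[symmetric] by (rule cancel)
  also have "\<dots> \<longleftrightarrow> \<sigma> T \<otimes>\<^bsub>Cl p q r\<^esub> Y \<otimes>\<^bsub>Cl p q r\<^esub> T = \<sigma> T \<otimes>\<^bsub>Cl p q r\<^esub> X \<otimes>\<^bsub>Cl p q r\<^esub> T"
  proof
    assume eq: "\<sigma> T \<otimes>\<^bsub>Cl p q r\<^esub> Y \<otimes>\<^bsub>Cl p q r\<^esub> T = \<sigma> T \<otimes>\<^bsub>Cl p q r\<^esub> X \<otimes>\<^bsub>Cl p q r\<^esub> T"
    have rc: "Z = Z \<otimes>\<^bsub>Cl p q r\<^esub> T \<otimes>\<^bsub>Cl p q r\<^esub> ?i" if "Z \<in> carrier (Cl p q r)" for Z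
      using that Tc T by (simp add: R.m_assoc)
    have "\<sigma> T \<otimes>\<^bsub>Cl p q r\<^esub> Y = \<sigma> T \<otimes>\<^bsub>Cl p q r\<^esub> X"
      using rc[of "\<sigma> T \<otimes>\<^bsub>Cl p q r\<^esub> Y"] rc[of "\<sigma> T \<otimes>\<^bsub>Cl p q r\<^esub> X"] eq Cl_mult_closed by metis
    then show "Y = X" using Units_image(1)[OF T] Xc Yc by simp
  qed simp
  also have "\<sigma> T \<otimes>\<^bsub>Cl p q r\<^esub> Y \<otimes>\<^bsub>Cl p q r\<^esub> T = V \<otimes>\<^bsub>Cl p q r\<^esub> W"
  proof -
    have "\<sigma> T \<otimes>\<^bsub>Cl p q r\<^esub> Y = (\<sigma> T \<otimes>\<^bsub>Cl p q r\<^esub> \<sigma> ?i) \<otimes>\<^bsub>Cl p q r\<^esub> (V \<otimes>\<^bsub>Cl p q r\<^esub> hat (\<sigma> T))"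
      unfolding Y_def by (simp only: Cl_mult_assoc)
    then show ?thesis unfolding inv1 W_def using Cl_mult_closed Cl_one_left Cl_mult_assoc by metis
  qed
  also have "\<sigma> T \<otimes>\<^bsub>Cl p q r\<^esub> X \<otimes>\<^bsub>Cl p q r\<^esub> T = hat W \<otimes>\<^bsub>Cl p q r\<^esub> V"
  proof -
    have "\<sigma> T \<otimes>\<^bsub>Cl p q r\<^esub> X \<otimes>\<^bsub>Cl p q r\<^esub> T =
        \<sigma> T \<otimes>\<^bsub>Cl p q r\<^esub> hat T \<otimes>\<^bsub>Cl p q r\<^esub> V \<otimes>\<^bsub>Cl p q r\<^esub> (?i \<otimes>\<^bsub>Cl p q r\<^esub> T)"
      unfolding X_def by (simp only: Cl_mult_assoc)
    then show ?thesis unfolding W_def hat_mult hat_hat R.Units_l_inv[OF T]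
      using Cl_one_right[OF Cl_mult_closed] by metis
  qed
  finally show ?thesis by metis
qed

lemma Gamma_eq_norm_preimage:
  assumes c: "c \<noteq> 0"
    and eig: "\<And>V. V \<in> carrier (Cl p q r) \<Longrightarrow> V \<in> qtype2 p q r k l \<longleftrightarrow> \<sigma> V = c \<odot>\<^bsub>Cl p q r\<^esub> V"
    and supp: "twisted_support p q r {m. m mod 4 \<in> {k mod 4, l mod 4}} = twisted_support p q r K"
  shows "Gamma p q r k l =
    {T \<in> Units (Cl p q r). hat (\<sigma> T) \<otimes>\<^bsub>Cl p q r\<^esub> T
      \<in> invertibles p q r (supported_on (twisted_support p q r K))}"
proof -
  have car: "qtype2 p q r k l \<subseteq> carrier (Cl p q r :: ('f, 'f mv) module)"
    unfolding qtype2_eq graded_span_def by blast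
  have "(\<forall>V\<in>qtype2 p q r k l. hat T \<otimes>\<^bsub>Cl p q r\<^esub> V \<otimes>\<^bsub>Cl p q r\<^esub> inv\<^bsub>Cl p q r\<^esub> T \<in> qtype2 p q r k l) \<longleftrightarrow>
      hat (\<sigma> T) \<otimes>\<^bsub>Cl p q r\<^esub> T \<in> invertibles p q r (supported_on (twisted_support p q r K))"
    if T: "T \<in> Units (Cl p q r)" for T
  proof -
    let ?W = "hat (\<sigma> T) \<otimes>\<^bsub>Cl p q r\<^esub> T"
    have "(\<forall>V\<in>qtype2 p q r k l. hat T \<otimes>\<^bsub>Cl p q r\<^esub> V \<otimes>\<^bsub>Cl p q r\<^esub> inv\<^bsub>Cl p q r\<^esub> T \<in> qtype2 p q r k l) \<longleftrightarrow>
      (\<forall>V\<in>qtype2 p q r k l. hat ?W \<otimes>\<^bsub>Cl p q r\<^esub> V = V \<otimes>\<^bsub>Cl p q r\<^esub> ?W)"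
    proof (intro ball_cong refl)
      fix V :: "'f mv" assume V: "V \<in> qtype2 p q r k l"
      then have Vc: "V \<in> carrier (Cl p q r)" using car by blast
      then have "\<sigma> V = c \<odot>\<^bsub>Cl p q r\<^esub> V" using V eig by simp
      from conjugate_eigenvector_iff[OF T Vc this c]
      show "hat T \<otimes>\<^bsub>Cl p q r\<^esub> V \<otimes>\<^bsub>Cl p q r\<^esub> inv\<^bsub>Cl p q r\<^esub> T \<in> qtype2 p q r k l \<longleftrightarrow>
          hat ?W \<otimes>\<^bsub>Cl p q r\<^esub> V = V \<otimes>\<^bsub>Cl p q r\<^esub> ?W"
        unfolding eig[OF Cl_mult_closed] .
    qed
    also have "\<dots> \<longleftrightarrow> ?W \<in> supported_on (twisted_support p q r K)"
      unfolding qtype2_eq twisted_commute_graded_span_iff_support[OF Cl_mult_closed] supp ..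
    also have "\<dots> \<longleftrightarrow> ?W \<in> invertibles p q r (supported_on (twisted_support p q r K))"
      unfolding invertibles_def using T Units_image by auto
    finally show ?thesis .
  qed
  then show ?thesis unfolding Gamma_def by blast
qed

end

lemma Cl_reversal_tilde: "Cl_reversal p q r (tilde :: 'f::field_char_0 mv \<Rightarrow> 'f mv)"
  by unfold_locales (simp_all add: tilde_closed tilde_one tilde_mult hat_tilde)

lemma Cl_reversal_conjugation: "Cl_reversal p q r (\<lambda>U :: 'f::field_char_0 mv. hat (tilde U))"
  by unfold_locales (simp_all add: tilde_closed hat_closed tilde_one hat_one tilde_mult hat_mult hat_tilde)

lemma qtype2_eigenspaces:
  fixes V :: "'f::field_char_0 mv"
  assumes "V \<in> carrier (Cl p q r)"
  shows "V \<in> qtype2 p q r 0 1 \<longleftrightarrow> tilde V = 1 \<odot>\<^bsub>Cl p q r\<^esub> V"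
    and "V \<in> qtype2 p q r 2 3 \<longleftrightarrow> tilde V = (- 1) \<odot>\<^bsub>Cl p q r\<^esub> V"
    and "V \<in> qtype2 p q r 0 3 \<longleftrightarrow> hat (tilde V) = 1 \<odot>\<^bsub>Cl p q r\<^esub> V"
    and "V \<in> qtype2 p q r 1 2 \<longleftrightarrow> hat (tilde V) = (- 1) \<odot>\<^bsub>Cl p q r\<^esub> V"
proof -
  have m4: "(m mod 4 = 0 \<or> m mod 4 = 1) \<or> (m mod 4 = 2 \<or> m mod 4 = 3)" for m :: nat by linarith
  have t: "tilde V A = (if card A mod 4 \<in> {0, 1} then V A else - V A)" for A
    unfolding tilde_def by (simp only: minus_one_power_iff even_triangular_iff) simp
  have ht: "hat (tilde V) A = (if card A mod 4 \<in> {0, 3} then V A else - V A)" for A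
  proof -
    have "even (card A) \<longleftrightarrow> card A mod 4 \<in> {0, 2}" by simp presburger
    then show ?thesis using m4[of "card A"] unfolding hat_def[of "tilde V"] t by (auto simp: minus_one_power_iff)
  qed
  have sm: "(c \<odot>\<^bsub>Cl p q r\<^esub> V) A = c * V A" for c :: 'f and A by (simp add: Cl_def)
  have neg: "x = - x \<longleftrightarrow> x = 0" "- x = x \<longleftrightarrow> x = 0" for x :: 'f by (simp_all add: eq_neg_iff_add_eq_0 neg_eq_iff_add_eq_0)
  show "V \<in> qtype2 p q r 0 1 \<longleftrightarrow> tilde V = 1 \<odot>\<^bsub>Cl p q r\<^esub> V"
    "V \<in> qtype2 p q r 2 3 \<longleftrightarrow> tilde V = (- 1) \<odot>\<^bsub>Cl p q r\<^esub> V"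
    "V \<in> qtype2 p q r 0 3 \<longleftrightarrow> hat (tilde V) = 1 \<odot>\<^bsub>Cl p q r\<^esub> V"
    "V \<in> qtype2 p q r 1 2 \<longleftrightarrow> hat (tilde V) = (- 1) \<odot>\<^bsub>Cl p q r\<^esub> V"
    unfolding qtype2_eq graded_span_def fun_eq_iff sm t ht using assms m4
    by (auto simp: neg) (metis neg)+
qed

lemma Units_subset_carrier: "Units (Cl p q r) \<subseteq> carrier (Cl p q r :: ('f::field, 'f mv) module)"
  unfolding Units_def by blast

lemma unit_norm_preimage:
  fixes N :: "'f::field mv \<Rightarrow> 'f mv"
  shows "{T \<in> carrier (Cl p q r). N T \<otimes>\<^bsub>Cl p q r\<^esub> T \<in> invertibles p q r H} =
    {T \<in> Units (Cl p q r). N T \<otimes>\<^bsub>Cl p q r\<^esub> T \<in> invertibles p q r H}"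
proof (intro Collect_cong)
  fix T :: "'f mv"
  show "T \<in> carrier (Cl p q r) \<and> N T \<otimes>\<^bsub>Cl p q r\<^esub> T \<in> invertibles p q r H \<longleftrightarrow>
    T \<in> Units (Cl p q r) \<and> N T \<otimes>\<^bsub>Cl p q r\<^esub> T \<in> invertibles p q r H"
    using Units_of_left_factor[of T p q r "N T"] Units_subset_carrier
    unfolding invertibles_def mem_Collect_eq by blast
qed

text \<open>
  For the pairs \<open>{1, 2}\<close> and \<open>{0, 3}\<close> the anti-automorphism is the Clifford conjugation, whose
  composition with \<open>hat\<close> is the reversion; for \<open>{0, 1}\<close> and \<open>{2, 3}\<close> it is the reversion, and the
  norm involves the conjugation.
\<close>

lemma Gamma_eq:
  shows "(Gamma p q r 1 2 :: 'f::field_char_0 mv set) = {T \<in> Units (Cl p q r). tilde T \<otimes>\<^bsub>Cl p q r\<^esub> T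
      \<in> invertibles p q r (supported_on (twisted_support p q r {1, 2}))}"
    and "(Gamma p q r 0 3 :: 'f mv set) = {T \<in> Units (Cl p q r). tilde T \<otimes>\<^bsub>Cl p q r\<^esub> T
      \<in> invertibles p q r (supported_on (twisted_support p q r {0, 3}))}"
    and "(Gamma p q r 0 1 :: 'f mv set) = {T \<in> Units (Cl p q r). hat (tilde T) \<otimes>\<^bsub>Cl p q r\<^esub> T
      \<in> invertibles p q r (supported_on (twisted_support p q r {0, 1}))}"
    and "(Gamma p q r 2 3 :: 'f mv set) = {T \<in> Units (Cl p q r). hat (tilde T) \<otimes>\<^bsub>Cl p q r\<^esub> T
      \<in> invertibles p q r (supported_on (twisted_support p q r {2, 3}))}"
proof -
  interpret t: Cl_reversal p q r "tilde :: 'f mv \<Rightarrow> 'f mv" by (rule Cl_reversal_tilde)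
  interpret b: Cl_reversal p q r "\<lambda>U :: 'f mv. hat (tilde U)" by (rule Cl_reversal_conjugation)
  show "(Gamma p q r 1 2 :: 'f mv set) = {T \<in> Units (Cl p q r). tilde T \<otimes>\<^bsub>Cl p q r\<^esub> T
      \<in> invertibles p q r (supported_on (twisted_support p q r {1, 2}))}"
    using b.Gamma_eq_norm_preimage[of "- 1" 1 2 "{1, 2}", OF _ qtype2_eigenspaces(4)]
      twisted_support_12[of p q r] by simp
  show "(Gamma p q r 0 3 :: 'f mv set) = {T \<in> Units (Cl p q r). tilde T \<otimes>\<^bsub>Cl p q r\<^esub> T
      \<in> invertibles p q r (supported_on (twisted_support p q r {0, 3}))}"
    using b.Gamma_eq_norm_preimage[of "1" 0 3 "{0, 3}", OF _ qtype2_eigenspaces(3)]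
      twisted_support_03[of p q r] by simp
  show "(Gamma p q r 0 1 :: 'f mv set) = {T \<in> Units (Cl p q r). hat (tilde T) \<otimes>\<^bsub>Cl p q r\<^esub> T
      \<in> invertibles p q r (supported_on (twisted_support p q r {0, 1}))}"
    using t.Gamma_eq_norm_preimage[of "1" 0 1 "{0, 1}", OF _ qtype2_eigenspaces(1)]
      twisted_support_01[of p q r] by simp
  show "(Gamma p q r 2 3 :: 'f mv set) = {T \<in> Units (Cl p q r). hat (tilde T) \<otimes>\<^bsub>Cl p q r\<^esub> T
      \<in> invertibles p q r (supported_on (twisted_support p q r {2, 3}))}"
    using t.Gamma_eq_norm_preimage[of "- 1" 2 3 "{2, 3}", OF _ qtype2_eigenspaces(2)]
      twisted_support_23[of p q r] by simp
qed

lemma norm_groups_eq_Gamma: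
  "(A12 p q r :: 'f::field_char_0 mv set)
      = psi_preimage p q r
          (invertibles p q r (twisted_centralizer p q r 1 \<inter> twisted_centralizer p q r 2)) \<and>
    psi_preimage p q r
          (invertibles p q r (twisted_centralizer p q r 1 \<inter> twisted_centralizer p q r 2))
      = (Gamma p q r 1 2 :: 'f mv set) \<and>
    (A03 p q r :: 'f mv set)
      = psi_preimage p q r (invertibles p q r (centralizer p q r 3 \<inter> even_part p q r)) \<and>
    psi_preimage p q r (invertibles p q r (centralizer p q r 3 \<inter> even_part p q r))
      = (Gamma p q r 0 3 :: 'f mv set) \<and>
    (B01 p q r :: 'f mv set)
      = chi_preimage p q r (invertibles p q r (Grassmann_even p q r)) \<and>
    chi_preimage p q r (invertibles p q r (Grassmann_even p q r))
      = (Gamma p q r 0 1 :: 'f mv set) \<and>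
    (Gamma p q r 0 1 :: 'f mv set) \<subseteq> B23 p q r \<and>
    (B23 p q r :: 'f mv set)
      = chi_preimage p q r
          (invertibles p q r (twisted_centralizer p q r 2 \<inter> twisted_centralizer p q r 3)) \<and>
    chi_preimage p q r
          (invertibles p q r (twisted_centralizer p q r 2 \<inter> twisted_centralizer p q r 3))
      = (Gamma p q r 2 3 :: 'f mv set)"
proof -
  have "(supported_on (twisted_support p q r {0, 1}) :: 'f mv set) \<subseteq>
      supported_on (twisted_support p q r {2, 3})"
    using twisted_support_01_subset[of p q r "{2, 3}"] unfolding supported_on_def by blast
  then show ?thesis
    unfolding A12_def A03_def B01_def B23_def psi_preimage_def psi_def
      chi_preimage_def chi_def unit_norm_preimage
      twisted_centralizer_Int centralizer_even_eq Grassmann_even_eq Gamma_eq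
    by (auto simp: invertibles_def)
qed

theorem theorem4p2:
  fixes p q r :: nat
  assumes "p + q + r \<ge> 1"
  shows
    "((A12 p q r :: real mv set)
          = psi_preimage p q r
              (invertibles p q r (twisted_centralizer p q r 1 \<inter> twisted_centralizer p q r 2)) \<and>
      psi_preimage p q r
              (invertibles p q r (twisted_centralizer p q r 1 \<inter> twisted_centralizer p q r 2))
          = (Gamma p q r 1 2 :: real mv set) \<and>
      (A03 p q r :: real mv set)
          = psi_preimage p q r (invertibles p q r (centralizer p q r 3 \<inter> even_part p q r)) \<and>
      psi_preimage p q r (invertibles p q r (centralizer p q r 3 \<inter> even_part p q r))
          = (Gamma p q r 0 3 :: real mv set) \<and>
      (B01 p q r :: real mv set)
          = chi_preimage p q r (invertibles p q r (Grassmann_even p q r)) \<and>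
      chi_preimage p q r (invertibles p q r (Grassmann_even p q r))
          = (Gamma p q r 0 1 :: real mv set) \<and>
      (Gamma p q r 0 1 :: real mv set) \<subseteq> B23 p q r \<and>
      (B23 p q r :: real mv set)
          = chi_preimage p q r
              (invertibles p q r (twisted_centralizer p q r 2 \<inter> twisted_centralizer p q r 3)) \<and>
      chi_preimage p q r
              (invertibles p q r (twisted_centralizer p q r 2 \<inter> twisted_centralizer p q r 3))
          = (Gamma p q r 2 3 :: real mv set))
   \<and>
     ((A12 (p + q) 0 r :: complex mv set)
          = psi_preimage (p + q) 0 r
              (invertibles (p + q) 0 r
                (twisted_centralizer (p + q) 0 r 1 \<inter> twisted_centralizer (p + q) 0 r 2)) \<and>
      psi_preimage (p + q) 0 r
              (invertibles (p + q) 0 r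
                (twisted_centralizer (p + q) 0 r 1 \<inter> twisted_centralizer (p + q) 0 r 2))
          = (Gamma (p + q) 0 r 1 2 :: complex mv set) \<and>
      (A03 (p + q) 0 r :: complex mv set)
          = psi_preimage (p + q) 0 r
              (invertibles (p + q) 0 r (centralizer (p + q) 0 r 3 \<inter> even_part (p + q) 0 r)) \<and>
      psi_preimage (p + q) 0 r
              (invertibles (p + q) 0 r (centralizer (p + q) 0 r 3 \<inter> even_part (p + q) 0 r))
          = (Gamma (p + q) 0 r 0 3 :: complex mv set) \<and>
      (B01 (p + q) 0 r :: complex mv set)
          = chi_preimage (p + q) 0 r (invertibles (p + q) 0 r (Grassmann_even (p + q) 0 r)) \<and>
      chi_preimage (p + q) 0 r (invertibles (p + q) 0 r (Grassmann_even (p + q) 0 r))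
          = (Gamma (p + q) 0 r 0 1 :: complex mv set) \<and>
      (Gamma (p + q) 0 r 0 1 :: complex mv set) \<subseteq> B23 (p + q) 0 r \<and>
      (B23 (p + q) 0 r :: complex mv set)
          = chi_preimage (p + q) 0 r
              (invertibles (p + q) 0 r
                (twisted_centralizer (p + q) 0 r 2 \<inter> twisted_centralizer (p + q) 0 r 3)) \<and>
      chi_preimage (p + q) 0 r
              (invertibles (p + q) 0 r
                (twisted_centralizer (p + q) 0 r 2 \<inter> twisted_centralizer (p + q) 0 r 3))
          = (Gamma (p + q) 0 r 2 3 :: complex mv set))"
  by (intro conjI[OF norm_groups_eq_Gamma norm_groups_eq_Gamma])

end
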